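(* Let $0\le i\le k\le \frac n2$. The irreducible component $V_{(n-i,i)}$ of the $\mathcal{S}_n$-module $\mathcal{S}f_k(n)$ has a basis consisting of polynomials of the form $$\Delta_{H_*J_*}\,\sigma_{k-i}^{L},\qquad H_*=(h_1,\dots,h_i),\ J_*=(j_1,\dots,j_i),\ H\sqcup J\sqcup L=\{1,\dots,n\},$$ where $H=\{h_1,\dots,h_i\}$, $J=\{j_1,\dots,j_i\}$ and $h_\alpha<j_\alpha$ for all $\alpha$.
   Context: $\mathcal{S}f(n)=\mathbb{Q}[x_1,\dots,x_n]/\langle x_1^2,\dots,x_n^2\rangle$ is the algebra of square free polynomials, with $\mathcal{S}_n$ permuting the variables; $\mathcal{S}f_k(n)$ is its degree $k$ homogeneous component, with basis the square free monomials $\mathbf{x}_A=\prod_{a\in A}x_a$, $A\subset\{1,\dots,n\}$, $|A|=k$. For $0\le k\le n/2$, $\mathcal{S}f_k(n)\cong V_{(n)}\oplus V_{(n-1,1)}\oplus\dots\oplus V_{(n-k,k)}$ is multiplicity free, where $V_\lambda$ is the irreducible $\mathbb{Q}[\mathcal{S}_n]$-module of the partition $\lambda$, so the component $V_{(n-i,i)}$ is a well-defined subspace. For a subset $B\subset\{1,\dots,n\}$, $\sigma_p^B=\sum_{C\subset B,\,|C|=p}\mathbf{x}_C$. For sequences $H_*=(h_1,\dots,h_s)$, $J_*=(j_1,\dots,j_s)$ with $h_\alpha<j_\alpha$ and all $2s$ entries distinct, $\Delta_{H_*J_*}=\prod_{\alpha=1}^s(x_{h_\alpha}-x_{j_\alpha})$.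 *)

theory Defs
  imports Complex_Main "HOL-Library.Cardinality" "HOL-Library.Poly_Mapping" "HOL-Combinatorics.Permutations"
begin

section \<open>Square free polynomials\<close>

text \<open>
  The index set \<open>{1, \<dots>, n}\<close> is a type \<open>'n :: {finite, linorder}\<close> with \<open>n = CARD('n)\<close>.
  Exponent vectors have type \<open>'n \<Rightarrow>\<^sub>0 nat\<close>, so that \<open>'n qpoly\<close> is the polynomial ring over
  the rationals in the variables indexed by \<open>'n\<close>.
\<close>

type_synonym 'n qpoly = "('n \<Rightarrow>\<^sub>0 nat) \<Rightarrow>\<^sub>0 rat"

definition qvar :: "'n \<Rightarrow> 'n qpoly"
  where "qvar i = Poly_Mapping.single (Poly_Mapping.single i 1) 1"

text \<open>Taking a commutative ring as a module over itself, \<open>module.span (*) S\<close> is the ideal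
  generated by \<open>S\<close>.\<close>

definition square_ideal :: "'n qpoly set"
  where "square_ideal = module.span (*) (range (\<lambda>i. qvar i ^ 2))"

definition sf_rel :: "'n qpoly \<Rightarrow> 'n qpoly \<Rightarrow> bool"
  where "sf_rel p q \<longleftrightarrow> p - q \<in> square_ideal"

lemma module_mult: "module ((*) :: 'a::comm_ring_1 \<Rightarrow> 'a \<Rightarrow> 'a)"
  by standard (simp_all add: algebra_simps)

lemma square_ideal_zero: "0 \<in> square_ideal"
  unfolding square_ideal_def by (rule module.span_zero[OF module_mult])

lemma square_ideal_add: "p \<in> square_ideal \<Longrightarrow> q \<in> square_ideal \<Longrightarrow> p + q \<in> square_ideal"
  unfolding square_ideal_def by (rule module.span_add[OF module_mult])

lemma square_ideal_mult: "p \<in> square_ideal \<Longrightarrow> r * p \<in> square_ideal"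
  unfolding square_ideal_def by (rule module.span_scale[OF module_mult])

lemma square_ideal_uminus: "p \<in> square_ideal \<Longrightarrow> - p \<in> square_ideal"
  unfolding square_ideal_def by (rule module.span_neg[OF module_mult])

lemma equivp_sf_rel: "equivp sf_rel"
proof (rule equivpI)
  show "reflp (sf_rel :: 'a qpoly \<Rightarrow> _)"
    by (rule reflpI) (simp add: sf_rel_def square_ideal_zero)
  show "symp (sf_rel :: 'a qpoly \<Rightarrow> _)"
  proof (rule sympI)
    fix p q :: "'a qpoly" assume "sf_rel p q"
    then show "sf_rel q p"
      using square_ideal_uminus[of "p - q"] by (simp add: sf_rel_def)
  qed
  show "transp (sf_rel :: 'a qpoly \<Rightarrow> _)"
  proof (rule transpI)
    fix p q r :: "'a qpoly" assume "sf_rel p q" "sf_rel q r"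
    then show "sf_rel p r"
      using square_ideal_add[of "p - q" "q - r"] by (simp add: sf_rel_def)
  qed
qed

quotient_type 'n sf = "'n qpoly" / sf_rel
  by (rule equivp_sf_rel)

instantiation sf :: (type) comm_ring_1
begin

lift_definition zero_sf :: "'a sf" is 0 .

lift_definition one_sf :: "'a sf" is 1 .

lift_definition plus_sf :: "'a sf \<Rightarrow> 'a sf \<Rightarrow> 'a sf" is "(+)"
proof -
  fix p p' q q' :: "'a qpoly" assume "sf_rel p p'" "sf_rel q q'"
  then show "sf_rel (p + q) (p' + q')"
    using square_ideal_add[of "p - p'" "q - q'"] by (simp add: sf_rel_def algebra_simps)
qed

lift_definition uminus_sf :: "'a sf \<Rightarrow> 'a sf" is uminus
proof -
  fix p q :: "'a qpoly" assume "sf_rel p q"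
  then show "sf_rel (- p) (- q)"
    using square_ideal_uminus[of "p - q"] by (simp add: sf_rel_def)
qed

lift_definition minus_sf :: "'a sf \<Rightarrow> 'a sf \<Rightarrow> 'a sf" is "(-)"
proof -
  fix p p' q q' :: "'a qpoly" assume "sf_rel p p'" "sf_rel q q'"
  then show "sf_rel (p - q) (p' - q')"
    using square_ideal_add[of "p - p'" "- (q - q')"] square_ideal_uminus[of "q - q'"]
    by (simp add: sf_rel_def algebra_simps)
qed

lift_definition times_sf :: "'a sf \<Rightarrow> 'a sf \<Rightarrow> 'a sf" is "(*)"
proof -
  fix p p' q q' :: "'a qpoly" assume "sf_rel p p'" "sf_rel q q'"
  then have "p * (q - q') + q' * (p - p') \<in> square_ideal"
    by (intro square_ideal_add square_ideal_mult) (simp_all add: sf_rel_def)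
  then show "sf_rel (p * q) (p' * q')"
    by (simp add: sf_rel_def algebra_simps)
qed

lemma one_notin_square_ideal: "(1 :: 'a qpoly) \<notin> square_ideal"
proof -
  have sq: "Poly_Mapping.lookup (r * qvar i ^ 2) 0 = 0" for r :: "'a qpoly" and i
  proof (rule ccontr)
    assume "Poly_Mapping.lookup (r * qvar i ^ 2) 0 \<noteq> 0"
    then have "0 \<in> Poly_Mapping.keys (r * qvar i ^ 2)"
      by (simp add: in_keys_iff)
    moreover have "qvar i ^ 2 = Poly_Mapping.single (Poly_Mapping.single i 2) (1::rat)"
      by (simp add: qvar_def power2_eq_square mult_single single_add[symmetric] numeral_2_eq_2)
    ultimately obtain a where "0 = a + Poly_Mapping.single i (2::nat)"
      using keys_mult[of r "qvar i ^ 2"] by auto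
    then have "Poly_Mapping.lookup (a + Poly_Mapping.single i (2::nat)) i = 0"
      by (metis lookup_zero)
    then show False by (simp add: lookup_add)
  qed
  have "Poly_Mapping.lookup p 0 = 0" if "p \<in> square_ideal" for p :: "'a qpoly"
    using that
    unfolding square_ideal_def module.span_explicit[OF module_mult]
    by (auto simp: lookup_sum intro!: sum.neutral) (use sq in blast)
  then show ?thesis by (metis lookup_one_zero one_neq_zero)
qed

instance
proof
  show "(0 :: 'a sf) \<noteq> 1"
  proof transfer
    show "\<not> sf_rel (0 :: 'a qpoly) 1"
      using one_notin_square_ideal square_ideal_uminus[of "- 1 :: 'a qpoly"]
      by (auto simp: sf_rel_def)
  qed
qed (transfer, simp add: sf_rel_def algebra_simps square_ideal_zero)+

end

lift_definition sf_scale :: "rat \<Rightarrow> 'n sf \<Rightarrow> 'n sf"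
  is "\<lambda>c p. Poly_Mapping.single 0 c * p"
proof -
  fix c :: rat and p q :: "'n qpoly" assume "sf_rel p q"
  then show "sf_rel (Poly_Mapping.single 0 c * p) (Poly_Mapping.single 0 c * q)"
    using square_ideal_mult[of "p - q" "Poly_Mapping.single 0 c"]
    by (simp add: sf_rel_def algebra_simps)
qed

interpretation sf: vector_space "sf_scale :: rat \<Rightarrow> 'n sf \<Rightarrow> 'n sf"
  by unfold_locales
    (transfer, simp add: sf_rel_def algebra_simps square_ideal_zero single_add
      mult_single mult.assoc[symmetric])+

lift_definition sf_var :: "'n \<Rightarrow> 'n sf" is qvar .

lemma sf_var_square: "sf_var i ^ 2 = 0"
proof -
  have "qvar i * qvar i \<in> square_ideal"
    unfolding square_ideal_def by (rule module.span_base[OF module_mult]) (auto simp: power2_eq_square)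
  then show ?thesis
    unfolding power2_eq_square by transfer (simp add: sf_rel_def)
qed

definition homogeneous :: "nat \<Rightarrow> 'n qpoly \<Rightarrow> bool"
  where "homogeneous k p \<longleftrightarrow>
    (\<forall>m \<in> Poly_Mapping.keys p. (\<Sum>i \<in> Poly_Mapping.keys m. Poly_Mapping.lookup m i) = k)"

definition sf_deg :: "nat \<Rightarrow> 'n sf set"
  where "sf_deg k = abs_sf ` {p. homogeneous k p}"

definition sf_mono :: "'n set \<Rightarrow> 'n sf"
  where "sf_mono A = (\<Prod>a\<in>A. sf_var a)"

definition sf_sigma :: "nat \<Rightarrow> 'n set \<Rightarrow> 'n sf"
  where "sf_sigma p B = (\<Sum>C | C \<subseteq> B \<and> card C = p. sf_mono C)"

definition sf_Delta :: "'n list \<Rightarrow> 'n list \<Rightarrow> 'n sf"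
  where "sf_Delta hs js = (\<Prod>\<alpha><length hs. sf_var (hs ! \<alpha>) - sf_var (js ! \<alpha>))"


section \<open>The action permuting the variables\<close>

definition mon_act :: "('n \<Rightarrow> 'n) \<Rightarrow> ('n \<Rightarrow>\<^sub>0 nat) \<Rightarrow> ('n \<Rightarrow>\<^sub>0 nat)"
  where "mon_act \<pi> m =
    (\<Sum>i \<in> Poly_Mapping.keys m. Poly_Mapping.single (\<pi> i) (Poly_Mapping.lookup m i))"

definition qpoly_act :: "('n \<Rightarrow> 'n) \<Rightarrow> 'n qpoly \<Rightarrow> 'n qpoly"
  where "qpoly_act \<pi> p =
    (\<Sum>m \<in> Poly_Mapping.keys p. Poly_Mapping.single (mon_act \<pi> m) (Poly_Mapping.lookup p m))"

lemma mon_act_superset: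
  assumes "finite K" "Poly_Mapping.keys m \<subseteq> K"
  shows "mon_act \<pi> m = (\<Sum>i\<in>K. Poly_Mapping.single (\<pi> i) (Poly_Mapping.lookup m i))"
  unfolding mon_act_def using assms
  by (intro sum.mono_neutral_left) (auto simp: in_keys_iff)

lemma mon_act_add: "mon_act \<pi> (m + m') = mon_act \<pi> m + mon_act \<pi> m'"
proof -
  let ?K = "Poly_Mapping.keys m \<union> Poly_Mapping.keys m'"
  have "Poly_Mapping.keys (m + m') \<subseteq> ?K" by (rule keys_add)
  then show ?thesis
    by (simp add: mon_act_superset[of ?K] lookup_add single_add sum.distrib)
qed

lemma mon_act_single: "mon_act \<pi> (Poly_Mapping.single i a) = Poly_Mapping.single (\<pi> i) a"
  by (simp add: mon_act_superset[of "{i}"])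

lemma qpoly_act_superset:
  assumes "finite K" "Poly_Mapping.keys p \<subseteq> K"
  shows "qpoly_act \<pi> p =
    (\<Sum>m\<in>K. Poly_Mapping.single (mon_act \<pi> m) (Poly_Mapping.lookup p m))"
  unfolding qpoly_act_def using assms
  by (intro sum.mono_neutral_left) (auto simp: in_keys_iff)

lemma qpoly_act_add: "qpoly_act \<pi> (p + q) = qpoly_act \<pi> p + qpoly_act \<pi> q"
proof -
  let ?K = "Poly_Mapping.keys p \<union> Poly_Mapping.keys q"
  have "Poly_Mapping.keys (p + q) \<subseteq> ?K" by (rule keys_add)
  then show ?thesis
    by (simp add: qpoly_act_superset[of ?K] lookup_add single_add sum.distrib)
qed

lemma qpoly_act_zero: "qpoly_act \<pi> 0 = 0"
  by (simp add: qpoly_act_def)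

lemma qpoly_act_sum: "qpoly_act \<pi> (\<Sum>a\<in>A. f a) = (\<Sum>a\<in>A. qpoly_act \<pi> (f a))"
  by (induction A rule: infinite_finite_induct) (simp_all add: qpoly_act_zero qpoly_act_add)

lemma qpoly_act_single:
  "qpoly_act \<pi> (Poly_Mapping.single m c) = Poly_Mapping.single (mon_act \<pi> m) c"
  by (simp add: qpoly_act_superset[of "{m}"])

lemma qpoly_act_uminus: "qpoly_act \<pi> (- p) = - qpoly_act \<pi> p"
  using qpoly_act_add[of \<pi> p "- p"] by (simp add: qpoly_act_zero eq_neg_iff_add_eq_0 add.commute)

lemma qpoly_sum_single:
  "(p :: 'n qpoly) =
    (\<Sum>m \<in> Poly_Mapping.keys p. Poly_Mapping.single m (Poly_Mapping.lookup p m))"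
  by (rule poly_mapping_eqI)
    (auto simp: lookup_sum lookup_single when_def in_keys_iff sum.delta' if_distrib)

lemma qpoly_act_mult: "qpoly_act \<pi> (p * q) = qpoly_act \<pi> p * qpoly_act \<pi> q"
proof -
  let ?s = "\<lambda>p m. Poly_Mapping.single m (Poly_Mapping.lookup p m) :: 'a qpoly"
  have "qpoly_act \<pi> (p * q) =
      qpoly_act \<pi> (\<Sum>m\<in>Poly_Mapping.keys p. \<Sum>m'\<in>Poly_Mapping.keys q. ?s p m * ?s q m')"
    by (subst (1) qpoly_sum_single[of p], subst (1) qpoly_sum_single[of q]) (simp add: sum_product)
  also have "\<dots> = qpoly_act \<pi> p * qpoly_act \<pi> q"
    unfolding qpoly_act_sum
    by (simp add: qpoly_act_def sum_product mult_single qpoly_act_single mon_act_add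
        flip: qpoly_act_def) (simp add: qpoly_act_single mult_single mon_act_add qpoly_act_def sum_product)
  finally show ?thesis .
qed

lemma qpoly_act_qvar: "qpoly_act \<pi> (qvar i) = qvar (\<pi> i)"
  by (simp add: qvar_def qpoly_act_single mon_act_single)

lemma qpoly_act_square_ideal:
  assumes "p \<in> square_ideal"
  shows "qpoly_act \<pi> p \<in> square_ideal"
proof -
  from assms obtain S r where S: "S \<subseteq> range (\<lambda>i. qvar i ^ 2)" and p: "p = (\<Sum>a\<in>S. r a * a)"
    unfolding square_ideal_def module.span_explicit[OF module_mult] by blast
  have "qpoly_act \<pi> a \<in> range (\<lambda>i. qvar i ^ 2)" if "a \<in> S" for a
    using that S by (auto simp: power2_eq_square qpoly_act_mult qpoly_act_qvar)
  then show ?thesis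
    unfolding p qpoly_act_sum qpoly_act_mult square_ideal_def
    by (intro module.span_sum[OF module_mult] module.span_scale[OF module_mult]
        module.span_base[OF module_mult])
qed

lift_definition sf_act :: "('n \<Rightarrow> 'n) \<Rightarrow> 'n sf \<Rightarrow> 'n sf" is qpoly_act
proof -
  fix \<pi> :: "'n \<Rightarrow> 'n" and p q :: "'n qpoly" assume "sf_rel p q"
  then show "sf_rel (qpoly_act \<pi> p) (qpoly_act \<pi> q)"
    using qpoly_act_square_ideal[of "p - q" \<pi>] qpoly_act_add[of \<pi> p "- q"]
    by (simp add: sf_rel_def qpoly_act_uminus)
qed

lemma sf_act_var: "sf_act \<pi> (sf_var i) = sf_var (\<pi> i)"
  by transfer (simp add: qpoly_act_qvar sf_rel_def square_ideal_zero)


section \<open>Specht modules\<close>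

text \<open>
  A partition is a weakly decreasing list of row lengths; trailing zeros are harmless, so
  \<open>[n, 0]\<close> stands for the partition \<open>(n)\<close>. A tableau of shape \<open>\<mu>\<close> is a bijection from the
  cells of the Young diagram onto the index set.
\<close>

definition cells :: "nat list \<Rightarrow> (nat \<times> nat) set"
  where "cells \<mu> = {(r, c). r < length \<mu> \<and> c < \<mu> ! r}"

definition tableau :: "nat list \<Rightarrow> (nat \<times> nat \<Rightarrow> 'n) \<Rightarrow> bool"
  where "tableau \<mu> T \<longleftrightarrow> bij_betw T (cells \<mu>) UNIV"

definition tab_row :: "nat list \<Rightarrow> (nat \<times> nat \<Rightarrow> 'n) \<Rightarrow> 'n \<Rightarrow> nat"
  where "tab_row \<mu> T x = fst (inv_into (cells \<mu>) T x)"

definition tab_col :: "nat list \<Rightarrow> (nat \<times> nat \<Rightarrow> 'n) \<Rightarrow> 'n \<Rightarrow> nat"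
  where "tab_col \<mu> T x = snd (inv_into (cells \<mu>) T x)"

definition col_stabilizer :: "nat list \<Rightarrow> (nat \<times> nat \<Rightarrow> 'n) \<Rightarrow> ('n \<Rightarrow> 'n) set"
  where "col_stabilizer \<mu> T = {\<pi>. \<pi> permutes UNIV \<and> (\<forall>x. tab_col \<mu> T (\<pi> x) = tab_col \<mu> T x)}"

text \<open>
  The tabloid (row equivalence class) of \<open>T\<close> is encoded by the function \<open>tab_row \<mu> T\<close> sending
  each entry to the row it lies in. Formal rational combinations of tabloids have type
  \<open>('n \<Rightarrow> nat) \<Rightarrow>\<^sub>0 rat\<close>.
\<close>

type_synonym 'n tabloids = "('n \<Rightarrow> nat) \<Rightarrow>\<^sub>0 rat"

definition tbl_scale :: "rat \<Rightarrow> 'n tabloids \<Rightarrow> 'n tabloids"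
  where "tbl_scale c v = Poly_Mapping.map ((*) c) v"

lemma lookup_tbl_scale: "Poly_Mapping.lookup (tbl_scale c v) t = c * Poly_Mapping.lookup v t"
  by (simp add: tbl_scale_def map.rep_eq when_def)

interpretation tbl: vector_space "tbl_scale :: rat \<Rightarrow> 'n tabloids \<Rightarrow> 'n tabloids"
  by unfold_locales
    (rule poly_mapping_eqI, simp add: lookup_tbl_scale lookup_add algebra_simps)+

definition tbl_act :: "('n \<Rightarrow> 'n) \<Rightarrow> 'n tabloids \<Rightarrow> 'n tabloids"
  where "tbl_act \<pi> v =
    (\<Sum>t \<in> Poly_Mapping.keys v. Poly_Mapping.single (t \<circ> inv \<pi>) (Poly_Mapping.lookup v t))"

definition polytabloid :: "nat list \<Rightarrow> (nat \<times> nat \<Rightarrow> 'n) \<Rightarrow> 'n tabloids"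
  where "polytabloid \<mu> T =
    (\<Sum>\<pi> \<in> col_stabilizer \<mu> T.
      Poly_Mapping.single (tab_row \<mu> (\<pi> \<circ> T)) (of_int (sign \<pi>)))"

definition specht :: "nat list \<Rightarrow> 'n tabloids set"
  where "specht \<mu> = tbl.span {polytabloid \<mu> T |T. tableau \<mu> T}"


section \<open>Irreducible components\<close>

definition sf_submodule :: "'n sf set \<Rightarrow> bool"
  where "sf_submodule U \<longleftrightarrow>
    sf.subspace U \<and> (\<forall>\<pi>. \<pi> permutes UNIV \<longrightarrow> (\<forall>u\<in>U. sf_act \<pi> u \<in> U))"

definition specht_iso :: "nat list \<Rightarrow> 'n sf set \<Rightarrow> bool"
  where "specht_iso \<mu> U \<longleftrightarrow> (\<exists>\<phi>.
    (\<forall>u \<in> specht \<mu>. \<forall>v \<in> specht \<mu>. \<phi> (u + v) = \<phi> u + \<phi> v) \<and>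
    (\<forall>c. \<forall>v \<in> specht \<mu>. \<phi> (tbl_scale c v) = sf_scale c (\<phi> v)) \<and>
    (\<forall>\<pi>. \<pi> permutes UNIV \<longrightarrow> (\<forall>v \<in> specht \<mu>. \<phi> (tbl_act \<pi> v) = sf_act \<pi> (\<phi> v))) \<and>
    bij_betw \<phi> (specht \<mu>) U)"

text \<open>
  The \<open>V\<^sub>\<mu>\<close>-component of the degree \<open>k\<close> part is the sum of all its submodules isomorphic to the
  Specht module of shape \<open>\<mu>\<close>. When \<open>V\<^sub>\<mu>\<close> occurs with multiplicity one, it is the unique such
  submodule.
\<close>

definition sf_component :: "nat \<Rightarrow> nat list \<Rightarrow> 'n sf set"
  where "sf_component k \<mu> =
    sf.span (\<Union>{U. sf_submodule U \<and> U \<subseteq> sf_deg k \<and> specht_iso \<mu> U})"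

end

theory Submission
  imports Defs
begin

text \<open>
  A square free polynomial is identified with its coefficient function on subsets. If \<open>\<phi>\<close> is a
  homomorphism from the Specht module of shape \<open>(n - i, i)\<close> to the degree \<open>k\<close> part, then the
  image of the polytabloid of \<open>T\<close> changes sign under swapping the two entries of any column of
  length two and is invariant under permuting the remaining entries. In degree \<open>k\<close> these
  symmetries leave only the multiples of \<open>\<Delta> \<sigma>\<close>, so every submodule isomorphic to the
  Specht module lies in the span of the generators. Conversely, the inclusion map sending an
  \<open>i\<close>-subset to the sum of all \<open>k\<close>-subsets containing it sends polytabloids to generators. It is
  injective on the Specht module: followed by the map that sums over all sets disjoint from a
  given \<open>i\<close>-subset it multiplies each polytabloid, again by its symmetries, by
  \<open>(-1)\<^sup>i\<close> times the binomial coefficient \<open>n - 2i\<close> choose \<open>k - i\<close>. A basis is then any maximal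
  independent set of generators.
\<close>

section \<open>Coefficients of square free polynomials\<close>

definition sqfree_exp :: "'n::finite set \<Rightarrow> 'n \<Rightarrow>\<^sub>0 nat"
  where "sqfree_exp A = (\<Sum>a\<in>A. Poly_Mapping.single a 1)"

lemma lookup_sqfree_exp: "Poly_Mapping.lookup (sqfree_exp A) x = of_bool (x \<in> A)"
  by (simp add: sqfree_exp_def lookup_sum lookup_single when_def)

lemma keys_sqfree_exp: "Poly_Mapping.keys (sqfree_exp A) = A"
  by (auto simp: in_keys_iff lookup_sqfree_exp)

lemma sqfree_exp_eq_iff: "sqfree_exp A = sqfree_exp B \<longleftrightarrow> A = B"
  by (metis keys_sqfree_exp)

lemma qvar_square: "qvar i ^ 2 = Poly_Mapping.single (Poly_Mapping.single i 2) 1"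
  by (simp add: qvar_def power2_eq_square mult_single single_add[symmetric] numeral_2_eq_2)

text \<open>Every monomial in a multiple of \<open>qvar i ^ 2\<close> has exponent at least 2 at
  \<open>i\<close>, while square free exponents are at most 1. Hence reading off square free
  coefficients descends to the quotient.\<close>

lemma lookup_square_ideal_sqfree_exp:
  assumes "p \<in> square_ideal"
  shows "Poly_Mapping.lookup p (sqfree_exp A) = 0"
proof -
  have sq: "Poly_Mapping.lookup (r * qvar i ^ 2) (sqfree_exp A) = 0" for r :: "'a qpoly" and i
  proof (rule ccontr)
    assume "Poly_Mapping.lookup (r * qvar i ^ 2) (sqfree_exp A) \<noteq> 0"
    then have "sqfree_exp A \<in> Poly_Mapping.keys (r * qvar i ^ 2)"
      by (simp add: in_keys_iff)
    then obtain a where "sqfree_exp A = a + Poly_Mapping.single i (2::nat)"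
      using keys_mult[of r "qvar i ^ 2"] by (auto simp: qvar_square)
    then have "of_bool (i \<in> A) = Poly_Mapping.lookup (a + Poly_Mapping.single i (2::nat)) i"
      by (metis lookup_sqfree_exp)
    then show False by (simp add: lookup_add of_bool_def split: if_splits)
  qed
  show ?thesis
    using assms
    unfolding square_ideal_def module.span_explicit[OF module_mult]
    by (auto simp: lookup_sum intro!: sum.neutral) (use sq in blast)
qed

lift_definition sf_coeff :: "'n::finite sf \<Rightarrow> 'n set \<Rightarrow> rat"
  is "\<lambda>p A. Poly_Mapping.lookup p (sqfree_exp A)"
proof
  fix p q :: "'n qpoly" and A assume "sf_rel p q"
  then show "Poly_Mapping.lookup p (sqfree_exp A) = Poly_Mapping.lookup q (sqfree_exp A)"
    using lookup_square_ideal_sqfree_exp[of "p - q" A] by (simp add: sf_rel_def lookup_minus)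
qed

lemma sf_coeff_add: "sf_coeff (u + v) A = sf_coeff u A + sf_coeff v A"
  by transfer (simp add: lookup_add)

lemma sf_coeff_diff: "sf_coeff (u - v) A = sf_coeff u A - sf_coeff v A"
  by transfer (simp add: lookup_minus)

lemma sf_coeff_zero: "sf_coeff 0 A = 0"
  by transfer simp

lemma sf_coeff_sum: "sf_coeff (\<Sum>x\<in>X. f x) A = (\<Sum>x\<in>X. sf_coeff (f x) A)"
  by (induction X rule: infinite_finite_induct) (simp_all add: sf_coeff_zero sf_coeff_add)

lemma single_zero_mult: "Poly_Mapping.single 0 c * p = Poly_Mapping.map ((*) c) (p :: 'n qpoly)"
  by (simp add: mult_map_scale_conv_mult)

lemma sf_coeff_scale: "sf_coeff (sf_scale c u) A = c * sf_coeff u A"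
  by transfer (simp add: single_zero_mult map.rep_eq when_def)

lemma abs_sf_add: "abs_sf (p + q) = abs_sf p + abs_sf q"
  by (simp add: plus_sf.abs_eq)

lemma abs_sf_sum: "abs_sf (\<Sum>x\<in>X. f x) = (\<Sum>x\<in>X. abs_sf (f x))"
  by (induction X rule: infinite_finite_induct) (simp_all add: abs_sf_add zero_sf_def)

lemma abs_sf_prod: "abs_sf (\<Prod>x\<in>X. f x) = (\<Prod>x\<in>X. abs_sf (f x))"
  by (induction X rule: infinite_finite_induct) (simp_all add: one_sf_def flip: times_sf.abs_eq)

lemma prod_qvar: "(\<Prod>a\<in>A. qvar a) = Poly_Mapping.single (sqfree_exp A) 1"
  for A :: "'n::finite set"
proof -
  have "finite A" by simp
  then show ?thesis
    by (induction A rule: finite_induct)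
      (simp_all add: sqfree_exp_def qvar_def mult_single)
qed

lemma sf_mono_abs: "sf_mono A = abs_sf (Poly_Mapping.single (sqfree_exp A) 1)"
  by (simp add: sf_mono_def sf_var_def flip: prod_qvar abs_sf_prod)

lemma sf_coeff_mono: "sf_coeff (sf_mono A) B = of_bool (A = B)"
  by (simp add: sf_mono_abs sf_coeff.abs_eq lookup_single when_def sqfree_exp_eq_iff)

lemma abs_sf_single_eq_zero:
  assumes "Poly_Mapping.lookup m a \<ge> 2"
  shows "abs_sf (Poly_Mapping.single m c) = 0"
proof -
  have "m = (m - Poly_Mapping.single a 2) + Poly_Mapping.single a 2"
    by (rule poly_mapping_eqI) (use assms in \<open>auto simp: lookup_add lookup_minus lookup_single when_def\<close>)
  then have "Poly_Mapping.single m c =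
      Poly_Mapping.single (m - Poly_Mapping.single a 2) c * qvar a ^ 2"
    by (simp add: qvar_square mult_single)
  moreover have "qvar a ^ 2 \<in> square_ideal"
    unfolding square_ideal_def by (rule module.span_base[OF module_mult]) auto
  ultimately have "Poly_Mapping.single m c \<in> square_ideal"
    by (simp add: square_ideal_mult)
  then show ?thesis
    by (simp add: zero_sf_def sf.abs_eq_iff sf_rel_def)
qed

lemma sqfree_exp_keys:
  assumes "\<And>a. Poly_Mapping.lookup m a < 2"
  shows "m = sqfree_exp (Poly_Mapping.keys m)"
proof (rule poly_mapping_eqI)
  fix a show "Poly_Mapping.lookup m a = Poly_Mapping.lookup (sqfree_exp (Poly_Mapping.keys m)) a"
    using assms[of a] by (auto simp: lookup_sqfree_exp in_keys_iff)
qed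

text \<open>Both sides are additive in \<open>u\<close>, so it suffices to check the class of a
  single monomial: it vanishes if some exponent is at least 2, and otherwise it is a multiple of
  some \<open>sf_mono A\<close>. With \<open>sf_coeff_mono\<close> this makes the square free
  monomials a basis.\<close>

lemma sf_expand: "u = (\<Sum>A\<in>UNIV. sf_scale (sf_coeff u A) (sf_mono A))"
proof -
  let ?e = "\<lambda>u. \<Sum>A\<in>UNIV. sf_scale (sf_coeff u A) (sf_mono A)"
  have single: "abs_sf (Poly_Mapping.single m c) = ?e (abs_sf (Poly_Mapping.single m c))" for m c
  proof (cases "\<exists>a. Poly_Mapping.lookup m a \<ge> 2")
    case True
    then show ?thesis by (auto simp: abs_sf_single_eq_zero sf_coeff_zero)
  next
    case False
    then obtain A where m: "m = sqfree_exp A"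
      using sqfree_exp_keys[of m] by (meson not_le)
    have "abs_sf (Poly_Mapping.single m c) = sf_scale c (sf_mono A)"
      by (simp add: m sf_mono_abs sf_scale.abs_eq mult_single)
    moreover have "?e (sf_scale c (sf_mono A)) = (\<Sum>B\<in>{A}. sf_scale c (sf_mono B))"
      by (rule sum.mono_neutral_cong_right) (auto simp: sf_coeff_scale sf_coeff_mono)
    ultimately show ?thesis by simp
  qed
  have sum: "?e (\<Sum>x\<in>X. f x) = (\<Sum>x\<in>X. ?e (f x))" for X and f :: "('a \<Rightarrow>\<^sub>0 nat) \<Rightarrow> 'a sf"
    by (simp add: sf_coeff_sum sf.scale_sum_left) (rule sum.swap)
  obtain p where "u = abs_sf p"
    using sf.abs_induct[of "\<lambda>u. \<exists>p. u = abs_sf p" u] by blast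
  define f where "f m = abs_sf (Poly_Mapping.single m (Poly_Mapping.lookup p m))" for m
  have u: "u = (\<Sum>m\<in>Poly_Mapping.keys p. f m)"
    unfolding \<open>u = abs_sf p\<close> f_def abs_sf_sum[symmetric] by (rule arg_cong[OF qpoly_sum_single])
  also have "\<dots> = (\<Sum>m\<in>Poly_Mapping.keys p. ?e (f m))"
    unfolding f_def by (intro sum.cong refl single)
  also have "\<dots> = ?e u"
    unfolding u by (rule sum[symmetric])
  finally show ?thesis .
qed

lemma sf_eqI:
  assumes "\<And>A. sf_coeff u A = sf_coeff v A"
  shows "u = v"
  by (subst sf_expand[of u], subst sf_expand[of v]) (simp only: assms)

definition sf_of :: "('n::finite set \<Rightarrow> rat) \<Rightarrow> 'n sf"
  where "sf_of F = (\<Sum>A\<in>UNIV. sf_scale (F A) (sf_mono A))"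

lemma sf_coeff_of: "sf_coeff (sf_of F) A = F A"
  by (simp add: sf_of_def sf_coeff_sum sf_coeff_scale sf_coeff_mono)

text \<open>A homogeneous representative has only square free terms of size \<open>k\<close>,
  besides terms that vanish in the quotient. Conversely, the representative built from the square
  free coefficients alone is homogeneous.\<close>

lemma sf_deg_iff: "u \<in> sf_deg k \<longleftrightarrow> (\<forall>A. sf_coeff u A \<noteq> 0 \<longrightarrow> card A = k)"
proof
  assume "u \<in> sf_deg k"
  then obtain p where p: "homogeneous k p" and u: "u = abs_sf p"
    by (auto simp: sf_deg_def)
  show "\<forall>A. sf_coeff u A \<noteq> 0 \<longrightarrow> card A = k"
  proof (intro allI impI)
    fix A assume "sf_coeff u A \<noteq> 0"
    then have "sqfree_exp A \<in> Poly_Mapping.keys p"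
      by (simp add: u sf_coeff.abs_eq in_keys_iff)
    then have "(\<Sum>a\<in>A. Poly_Mapping.lookup (sqfree_exp A) a) = k"
      using p by (force simp: homogeneous_def keys_sqfree_exp)
    then show "card A = k" by (simp add: lookup_sqfree_exp)
  qed
next
  assume deg: "\<forall>A. sf_coeff u A \<noteq> 0 \<longrightarrow> card A = k"
  let ?p = "\<Sum>A\<in>UNIV. Poly_Mapping.single (sqfree_exp A) (sf_coeff u A)"
  have "homogeneous k ?p"
    unfolding homogeneous_def
  proof
    fix m assume "m \<in> Poly_Mapping.keys ?p"
    then have "m \<in> (\<Union>A\<in>UNIV. Poly_Mapping.keys (Poly_Mapping.single (sqfree_exp A) (sf_coeff u A)))"
      by (rule subsetD[OF keys_sum])
    then obtain A where "m \<in> Poly_Mapping.keys (Poly_Mapping.single (sqfree_exp A) (sf_coeff u A))"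
      by blast
    then have "m = sqfree_exp A" "sf_coeff u A \<noteq> 0" by (auto split: if_splits)
    then show "(\<Sum>i\<in>Poly_Mapping.keys m. Poly_Mapping.lookup m i) = k"
      using deg by (simp add: keys_sqfree_exp lookup_sqfree_exp)
  qed
  moreover have "abs_sf ?p = u"
    by (rule sf_eqI)
      (simp add: sf_coeff.abs_eq lookup_sum lookup_single when_def sqfree_exp_eq_iff)
  ultimately show "u \<in> sf_deg k" 
    unfolding sf_deg_def by (intro image_eqI[of u abs_sf ?p]) simp_all
qed

text \<open>Multiplication by \<open>sf_var h\<close> inserts \<open>h\<close> into each monomial
  and kills those already containing \<open>h\<close>. This drives the induction over the factors of
  \<open>sf_Delta\<close>.\<close>

lemma sf_coeff_var_mult:
  "sf_coeff (sf_var h * u) A = (if h \<in> A then sf_coeff u (A - {h}) else 0)"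
proof -
  have var_mono: "sf_var h * sf_mono B = (if h \<in> B then 0 else sf_mono (insert h B))" for B
  proof (cases "h \<in> B")
    case True
    then have "sf_mono B = sf_var h * sf_mono (B - {h})"
      by (simp add: sf_mono_def prod.remove[of B h])
    then have "sf_var h * sf_mono B = sf_var h ^ 2 * sf_mono (B - {h})"
      by (simp only: power2_eq_square mult.assoc)
    then show ?thesis
      using True by (simp add: sf_var_square)
  qed (simp add: sf_mono_def)
  have scale: "x * sf_scale c y = sf_scale c (x * y)" for c and x y :: "'a sf"
    by transfer (simp add: sf_rel_def square_ideal_zero mult.left_commute)
  have "sf_coeff (sf_var h * u) A =
      (\<Sum>B\<in>UNIV. sf_coeff u B * sf_coeff (sf_var h * sf_mono B) A)"
    unfolding arg_cong[OF sf_expand[of u], of "\<lambda>v. sf_coeff (sf_var h * v) A"]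
    by (simp add: sum_distrib_left sf_coeff_sum scale sf_coeff_scale)
  also have "\<dots> = (\<Sum>B\<in>UNIV. sf_coeff u B * of_bool (h \<notin> B \<and> insert h B = A))"
    by (intro sum.cong) (simp_all add: var_mono sf_coeff_mono sf_coeff_zero)
  also have "\<dots> = (if h \<in> A then sf_coeff u (A - {h}) else 0)"
  proof (cases "h \<in> A")
    case True
    then have "h \<notin> B \<and> insert h B = A \<longleftrightarrow> B = A - {h}" for B by auto
    then have "(\<Sum>B\<in>UNIV. sf_coeff u B * of_bool (h \<notin> B \<and> insert h B = A)) =
        (\<Sum>B\<in>UNIV. if B = A - {h} then sf_coeff u B else 0)"
      by (intro sum.cong) simp_all
    then show ?thesis using True by simp
  next
    case False
    then have "\<not> (h \<notin> B \<and> insert h B = A)" for B by auto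
    then show ?thesis using False by (simp only: of_bool_eq mult_zero_right sum.neutral_const if_False)
  qed
  finally show ?thesis .
qed

lemma sf_coeff_sigma: "sf_coeff (sf_sigma p B) A = of_bool (A \<subseteq> B \<and> card A = p)"
  by (simp add: sf_sigma_def sf_coeff_sum sf_coeff_mono of_bool_def)

section \<open>The action of permutations on coefficients\<close>

lemma sf_act_add: "sf_act \<pi> (u + v) = sf_act \<pi> u + sf_act \<pi> v"
  by transfer (simp add: qpoly_act_add sf_rel_def square_ideal_zero)

lemma sf_act_zero: "sf_act \<pi> 0 = 0"
  by transfer (simp add: qpoly_act_zero sf_rel_def square_ideal_zero)

lemma sf_act_sum: "sf_act \<pi> (\<Sum>x\<in>X. f x) = (\<Sum>x\<in>X. sf_act \<pi> (f x))"
  by (induction X rule: infinite_finite_induct) (simp_all add: sf_act_zero sf_act_add)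

lemma sf_act_mult: "sf_act \<pi> (u * v) = sf_act \<pi> u * sf_act \<pi> v"
  by transfer (simp add: qpoly_act_mult sf_rel_def square_ideal_zero)

lemma qpoly_act_const: "qpoly_act \<pi> (Poly_Mapping.single 0 c) = Poly_Mapping.single 0 c"
  by (simp add: qpoly_act_single mon_act_def)

lemma qpoly_act_one: "qpoly_act \<pi> 1 = 1"
  using qpoly_act_const[of \<pi> 1] by simp

lemma sf_act_one: "sf_act \<pi> 1 = 1"
  by transfer (simp add: qpoly_act_one sf_rel_def square_ideal_zero)

lemma sf_act_scale: "sf_act \<pi> (sf_scale c u) = sf_scale c (sf_act \<pi> u)"
  by transfer (simp add: qpoly_act_const qpoly_act_mult sf_rel_def square_ideal_zero)

lemma sf_act_mono:
  assumes "inj \<pi>"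
  shows "sf_act \<pi> (sf_mono A) = sf_mono (\<pi> ` A)"
proof -
  have "sf_act \<pi> (\<Prod>a\<in>A. sf_var a) = (\<Prod>a\<in>A. sf_var (\<pi> a))"
    by (induction A rule: infinite_finite_induct) (simp_all add: sf_act_one sf_act_mult sf_act_var)
  also have "\<dots> = (\<Prod>a\<in>\<pi> ` A. sf_var a)"
    by (simp add: prod.reindex[OF inj_on_subset[OF assms subset_UNIV]])
  finally show ?thesis by (simp add: sf_mono_def)
qed

text \<open>Evaluating at the image set avoids the inverse permutation; every set has this form
  because \<pi> is a bijection.\<close>

lemma sf_coeff_act:
  assumes "bij \<pi>"
  shows "sf_coeff (sf_act \<pi> u) (\<pi> ` A) = sf_coeff u A"
proof -
  have inj: "inj \<pi>" using assms by (rule bij_is_inj)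
  have "sf_act \<pi> u = (\<Sum>B\<in>UNIV. sf_scale (sf_coeff u B) (sf_mono (\<pi> ` B)))"
    by (subst sf_expand[of u]) (simp only: sf_act_sum sf_act_scale sf_act_mono[OF inj])
  then have "sf_coeff (sf_act \<pi> u) (\<pi> ` A) = (\<Sum>B\<in>UNIV. if B = A then sf_coeff u B else 0)"
    by (simp add: sf_coeff_sum sf_coeff_scale sf_coeff_mono inj_image_eq_iff[OF inj] of_bool_def
        if_distrib cong: if_cong)
  then show ?thesis by simp
qed

section \<open>Functions skew with respect to a pairing\<close>

text \<open>The sequences \<open>H\<close> and \<open>J\<close> become functions on indices below
  \<open>i\<close>. The order condition is left out because columns of an arbitrary tableau need not
  satisfy it; \<open>sf_of_pair_coeff_in_span\<close> restores it.\<close>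

definition pairing :: "nat \<Rightarrow> (nat \<Rightarrow> 'n) \<Rightarrow> (nat \<Rightarrow> 'n) \<Rightarrow> bool"
  where "pairing i h j \<longleftrightarrow>
    inj_on h {..<i} \<and> inj_on j {..<i} \<and> h ` {..<i} \<inter> j ` {..<i} = {}"

definition unpaired :: "nat \<Rightarrow> (nat \<Rightarrow> 'n) \<Rightarrow> (nat \<Rightarrow> 'n) \<Rightarrow> 'n set"
  where "unpaired i h j = - (h ` {..<i} \<union> j ` {..<i})"

text \<open>The contribution of the difference product: a factor is 1 or -1 if \<open>A\<close>
  contains just \<open>h c\<close> or just \<open>j c\<close>, and 0 if it contains both or
  neither.\<close>

definition pair_sign :: "nat \<Rightarrow> (nat \<Rightarrow> 'n) \<Rightarrow> (nat \<Rightarrow> 'n) \<Rightarrow> 'n set \<Rightarrow> rat"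
  where "pair_sign i h j A = (\<Prod>c<i. of_bool (h c \<in> A) - of_bool (j c \<in> A))"

text \<open>For a pairing this is the coefficient function of the generator (see
  \<open>sf_coeff_generator\<close>): a nonzero sign uses exactly \<open>i\<close> paired elements,
  so the size condition leaves \<open>p\<close> unpaired ones.\<close>

definition pair_coeff :: "nat \<Rightarrow> nat \<Rightarrow> (nat \<Rightarrow> 'n) \<Rightarrow> (nat \<Rightarrow> 'n) \<Rightarrow> 'n set \<Rightarrow> rat"
  where "pair_coeff i p h j A = pair_sign i h j A * of_bool (card A = i + p)"

definition skew :: "nat \<Rightarrow> (nat \<Rightarrow> 'n) \<Rightarrow> (nat \<Rightarrow> 'n) \<Rightarrow> ('n set \<Rightarrow> rat) \<Rightarrow> bool"
  where "skew i h j F \<longleftrightarrow>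
    (\<forall>c<i. \<forall>A. F (transpose (h c) (j c) ` A) = - F A) \<and>
    (\<forall>\<pi>. \<pi> permutes unpaired i h j \<longrightarrow> (\<forall>A. F (\<pi> ` A) = F A))"

lemma skewI:
  assumes "\<And>c A. c < i \<Longrightarrow> F (transpose (h c) (j c) ` A) = - F A"
    and "\<And>\<pi> A. \<pi> permutes unpaired i h j \<Longrightarrow> F (\<pi> ` A) = F A"
  shows "skew i h j F"
  using assms by (simp add: skew_def)

lemma skew_transpose: "skew i h j F \<Longrightarrow> c < i \<Longrightarrow> F (transpose (h c) (j c) ` A) = - F A"
  by (simp add: skew_def)

lemma skew_permutes: "skew i h j F \<Longrightarrow> \<pi> permutes unpaired i h j \<Longrightarrow> F (\<pi> ` A) = F A"
  by (simp add: skew_def)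

lemma pairing_neq:
  assumes "pairing i h j" "c < i" "d < i"
  shows "h c \<noteq> j d" "h c = h d \<longleftrightarrow> c = d" "j c = j d \<longleftrightarrow> c = d"
  using assms by (auto simp: pairing_def inj_on_eq_iff)

lemma pairing_notin:
  assumes "pairing i h j" "c < i"
  shows "h c \<notin> j ` {..<i}" "j c \<notin> h ` {..<i}"
  using assms by (auto simp: pairing_def)

lemma card_unpaired:
  fixes h :: "nat \<Rightarrow> 'n::finite"
  assumes "pairing i h j"
  shows "card (unpaired i h j) = CARD('n) - 2 * i"
proof -
  have "card (h ` {..<i} \<union> j ` {..<i}) = 2 * i"
    using assms by (simp add: pairing_def card_Un_disjoint card_image)
  then show ?thesis by (simp add: unpaired_def Compl_eq_Diff_UNIV card_Diff_subset)
qed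

lemma permutes_image_subset:
  assumes "finite L" "C \<subseteq> L" "D \<subseteq> L" "card C = card D"
  obtains \<pi> where "\<pi> permutes L" "\<pi> ` C = D"
proof -
  obtain f where f: "bij_betw f C D"
    using assms finite_same_card_bij by (metis finite_subset)
  have "card (L - C) = card (L - D)"
    using assms by (simp add: card_Diff_subset finite_subset)
  then obtain g where g: "bij_betw g (L - C) (L - D)"
    using assms finite_same_card_bij by (metis finite_Diff)
  define \<pi> where "\<pi> x = (if x \<in> C then f x else if x \<in> L then g x else x)" for x
  have C: "bij_betw \<pi> C D"
    using f by (rule bij_betw_cong[THEN iffD1, rotated]) (simp add: \<pi>_def)
  have "bij_betw \<pi> (L - C) (L - D)"
    using g by (rule bij_betw_cong[THEN iffD1, rotated]) (simp add: \<pi>_def)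
  with C have "bij_betw \<pi> (C \<union> (L - C)) (D \<union> (L - D))"
    by (rule bij_betw_combine) auto
  moreover have "C \<union> (L - C) = L" "D \<union> (L - D) = L" using assms by auto
  ultimately have "bij_betw \<pi> L L" by simp
  then have "\<pi> permutes L"
    by (rule bij_imp_permutes) (use assms in \<open>auto simp: \<pi>_def\<close>)
  with that C show thesis by (simp add: bij_betw_def)
qed

lemma permutes_unpaired_fix:
  assumes "\<pi> permutes unpaired i h j" "c < i"
  shows "\<pi> (h c) = h c" "\<pi> (j c) = j c"
  using assms by (auto simp: unpaired_def intro!: permutes_not_in[OF assms(1)])

text \<open>If \<open>A\<close> contains both or neither element of a pair, the swap fixes
  \<open>A\<close> and \<open>F A = - F A\<close>. Otherwise swaps replace the elements of
  \<open>J\<close> in \<open>A\<close> by their partners, up to sign, which is the induction on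
  their number. Once \<open>A\<close> consists of \<open>H\<close> and unpaired elements, a
  permutation of the latter moves it to the reference set.\<close>

lemma skew_eq_0I:
  fixes h :: "nat \<Rightarrow> 'n::finite"
  assumes pair: "pairing i h j" and skew: "skew i h j F"
    and supp: "\<And>A. F A \<noteq> 0 \<Longrightarrow> card A = i + p"
    and C: "C \<subseteq> unpaired i h j" "card C = p" and F0: "F (h ` {..<i} \<union> C) = 0"
  shows "F A = 0"
proof (induction "card (j ` {..<i} \<inter> A)" arbitrary: A rule: less_induct)
  case less
  show ?case
  proof (rule ccontr)
    assume nz: "F A \<noteq> 0"
    have split: "h c \<in> A \<longleftrightarrow> j c \<notin> A" if "c < i" for c
    proof (rule ccontr)
      assume "\<not> ?thesis"
      then have "transpose (h c) (j c) ` A = A"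
        by (intro transpose_image_eq) auto
      then show False using skew_transpose[OF skew that, of A] nz by simp
    qed
    show False
    proof (cases "\<exists>c<i. j c \<in> A")
      case True
      then obtain c where c: "c < i" "j c \<in> A" by blast
      let ?A = "transpose (h c) (j c) ` A"
      have A': "?A = insert (h c) (A - {j c})"
        using c split[of c] by (auto simp: transpose_def)
      have "j ` {..<i} \<inter> ?A \<subseteq> j ` {..<i} \<inter> A" "j c \<notin> ?A"
        using pairing_notin(1)[OF pair c(1)] pairing_neq(1)[OF pair c(1) c(1)] unfolding A' by auto
      then have "j ` {..<i} \<inter> ?A \<subset> j ` {..<i} \<inter> A"
        using c by blast
      then have "card (j ` {..<i} \<inter> ?A) < card (j ` {..<i} \<inter> A)"
        by (intro psubset_card_mono) auto
      then have "F ?A = 0" by (rule less)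
      then show False using skew_transpose[OF skew c(1), of A] nz by simp
    next
      case False
      define D where "D = A \<inter> unpaired i h j"
      have A: "A = h ` {..<i} \<union> D"
        using False split by (auto simp: D_def unpaired_def)
      have disj: "h ` {..<i} \<inter> D = {}" by (auto simp: D_def unpaired_def)
      have "card (h ` {..<i}) = i" using pair by (simp add: pairing_def card_image)
      then have "card D = p"
        using supp[OF nz] disj by (simp add: A card_Un_disjoint)
      then obtain \<pi> where \<pi>: "\<pi> permutes unpaired i h j" "\<pi> ` D = C"
        using C permutes_image_subset[of "unpaired i h j" D C] by (auto simp: D_def)
      have "\<pi> ` A = h ` {..<i} \<union> C"
        using \<pi> permutes_unpaired_fix(1)[OF \<pi>(1)] by (force simp: A image_Un image_image)
      then show False using skew_permutes[OF skew \<pi>(1), of A] F0 nz by simp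
    qed
  qed
qed

lemma pair_sign_nonzero: "pair_sign i h j A \<noteq> 0 \<longleftrightarrow> (\<forall>c<i. h c \<in> A \<longleftrightarrow> j c \<notin> A)"
  by (auto simp: pair_sign_def of_bool_def)

lemma skew_pair_coeff:
  fixes h :: "nat \<Rightarrow> 'n::finite"
  assumes "pairing i h j"
  shows "skew i h j (pair_coeff i p h j)"
proof (rule skewI)
  fix c A assume c: "c < i"
  let ?t = "transpose (h c) (j c)"
  have mem: "x \<in> ?t ` A \<longleftrightarrow> ?t x \<in> A" for x
    by (metis bij_transpose image_iff transpose_involutory)
  \<comment> \<open>As the pairs are disjoint, the swap negates the factor with index
    \<open>c\<close> and leaves all others alone.\<close>
  have "pair_sign i h j (?t ` A) =
      (\<Prod>d<i. (if d = c then -1 else 1) * (of_bool (h d \<in> A) - of_bool (j d \<in> A)))"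
    unfolding pair_sign_def mem
  proof (rule prod.cong[OF refl])
    fix d assume d: "d \<in> {..<i}"
    show "of_bool (?t (h d) \<in> A) - of_bool (?t (j d) \<in> A) =
        (if d = c then -1 else 1) * (of_bool (h d \<in> A) - of_bool (j d \<in> A) :: rat)"
      using pairing_neq[OF assms, of c d] pairing_neq[OF assms, of d c] c d
      by (cases "d = c") (auto simp: transpose_def)
  qed
  also have "\<dots> = - pair_sign i h j A"
    using c by (simp add: prod.distrib pair_sign_def prod.delta)
  finally show "pair_coeff i p h j (?t ` A) = - pair_coeff i p h j A"
    by (simp add: pair_coeff_def card_image inj_on_subset[OF inj_transpose])
next
  fix \<pi> A assume \<pi>: "\<pi> permutes unpaired i h j"
  have inj: "inj \<pi>" using \<pi> by (rule permutes_inj)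
  have "h c \<in> \<pi> ` A \<longleftrightarrow> h c \<in> A" "j c \<in> \<pi> ` A \<longleftrightarrow> j c \<in> A" if "c < i" for c
    using permutes_unpaired_fix[OF \<pi> that] by (metis inj inj_image_mem_iff)+
  then have "pair_sign i h j (\<pi> ` A) = pair_sign i h j A"
    by (simp add: pair_sign_def)
  then show "pair_coeff i p h j (\<pi> ` A) = pair_coeff i p h j A"
    by (simp add: pair_coeff_def card_image inj_on_subset[OF inj])
qed

lemma pair_coeff_top:
  fixes h :: "nat \<Rightarrow> 'n::finite"
  assumes "pairing i h j" "C \<subseteq> unpaired i h j" "card C = p"
  shows "pair_coeff i p h j (h ` {..<i} \<union> C) = 1"
proof -
  have "card (h ` {..<i}) = i" using assms by (simp add: pairing_def card_image)
  moreover have "h ` {..<i} \<inter> C = {}" using assms by (auto simp: unpaired_def)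
  ultimately have "card (h ` {..<i} \<union> C) = i + p"
    using assms by (simp add: card_Un_disjoint)
  moreover have "h c \<in> h ` {..<i} \<union> C" "j c \<notin> h ` {..<i} \<union> C" if "c < i" for c
    using assms(2) that pairing_notin(2)[OF assms(1) that] by (auto simp: unpaired_def)
  ultimately show ?thesis by (simp add: pair_coeff_def pair_sign_def)
qed

text \<open>The skew functions in one degree form a line: subtracting the multiple of
  \<open>pair_coeff\<close> that agrees with \<open>F\<close> at the reference set leaves a skew
  function vanishing there, hence everywhere. All later identities and the rigidity of homomorphisms
  reduce to evaluation at one set.\<close>

lemma skew_eq_pair_coeff:
  fixes h :: "nat \<Rightarrow> 'n::finite"
  assumes pair: "pairing i h j" and skew: "skew i h j F"
    and supp: "\<And>A. F A \<noteq> 0 \<Longrightarrow> card A = i + p"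
    and C: "C \<subseteq> unpaired i h j" "card C = p"
  shows "F A = F (h ` {..<i} \<union> C) * pair_coeff i p h j A"
proof -
  let ?a = "F (h ` {..<i} \<union> C)"
  let ?G = "\<lambda>A. F A - ?a * pair_coeff i p h j A"
  have "skew i h j ?G"
    by (rule skewI)
      (simp_all add: skew_transpose[OF skew] skew_permutes[OF skew]
        skew_transpose[OF skew_pair_coeff[OF pair]] skew_permutes[OF skew_pair_coeff[OF pair]])
  moreover have "card A = i + p" if "?G A \<noteq> 0" for A
    using that supp[of A] by (auto simp: pair_coeff_def of_bool_def split: if_splits)
  moreover have "?G (h ` {..<i} \<union> C) = 0"
    by (simp add: pair_coeff_top[OF pair C])
  ultimately have "?G A = 0"
    using pair C by (rule_tac skew_eq_0I[where F = ?G])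
  then show ?thesis by simp
qed

section \<open>Inclusion and disjointness maps between functions on subsets\<close>

definition raise :: "nat \<Rightarrow> nat \<Rightarrow> ('n::finite set \<Rightarrow> rat) \<Rightarrow> 'n set \<Rightarrow> rat"
  where "raise i k E B = of_bool (card B = k) * (\<Sum>D | D \<subseteq> B \<and> card D = i. E D)"

text \<open>\<open>B\<close> ranges over sets of every size; the degree is imposed by the support of
  \<open>F\<close>. Disjointness is convenient because at \<open>D = H\<close> only sets containing
  all of \<open>J\<close> contribute for a \<open>pair_coeff\<close>, all with the same
  sign.\<close>

definition lower :: "nat \<Rightarrow> ('n::finite set \<Rightarrow> rat) \<Rightarrow> 'n set \<Rightarrow> rat"
  where "lower i F D = of_bool (card D = i) * (\<Sum>B | B \<inter> D = {}. F B)"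

lemma bij_betw_image_Collect:
  fixes \<pi> :: "'a \<Rightarrow> 'a"
  assumes "bij \<pi>" "\<And>A. P (\<pi> ` A) \<longleftrightarrow> Q A"
  shows "bij_betw ((`) \<pi>) {A. Q A} {A. P A}"
proof (rule bij_betw_byWitness[where f' = "(`) (inv \<pi>)"])
  have inv: "inv \<pi> ` \<pi> ` A = A" "\<pi> ` inv \<pi> ` A = A" for A
    using assms(1) by (simp_all add: image_comp bij_is_inj bij_is_surj surj_iff[THEN iffD1])
  then show "\<forall>A\<in>{A. Q A}. inv \<pi> ` \<pi> ` A = A" "\<forall>A\<in>{A. P A}. \<pi> ` inv \<pi> ` A = A" by auto
  show "(`) \<pi> ` {A. Q A} \<subseteq> {A. P A}" using assms(2) by auto
  show "(`) (inv \<pi>) ` {A. P A} \<subseteq> {A. Q A}"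
    using assms(2)[of "inv \<pi> ` A" for A] inv(2) by auto
qed

lemma raise_image:
  fixes E :: "'n::finite set \<Rightarrow> rat" and \<pi> :: "'n \<Rightarrow> 'n"
  assumes "bij \<pi>"
  shows "raise i k E (\<pi> ` B) = raise i k (\<lambda>D. E (\<pi> ` D)) B"
proof -
  have inj: "inj \<pi>" using assms by (rule bij_is_inj)
  have card: "card (\<pi> ` A) = card A" for A
    by (simp add: card_image inj_on_subset[OF inj])
  have "bij_betw ((`) \<pi>) {D. D \<subseteq> B \<and> card D = i} {D. D \<subseteq> \<pi> ` B \<and> card D = i}"
    by (rule bij_betw_image_Collect[OF assms]) (simp add: card inj_image_subset_iff[OF inj])
  then show ?thesis
    unfolding raise_def card by (simp add: sum.reindex_bij_betw[symmetric])
qed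

lemma lower_image:
  fixes F :: "'n::finite set \<Rightarrow> rat" and \<pi> :: "'n \<Rightarrow> 'n"
  assumes "bij \<pi>"
  shows "lower i F (\<pi> ` D) = lower i (\<lambda>B. F (\<pi> ` B)) D"
proof -
  have inj: "inj \<pi>" using assms by (rule bij_is_inj)
  have card: "card (\<pi> ` A) = card A" for A
    by (simp add: card_image inj_on_subset[OF inj])
  have "bij_betw ((`) \<pi>) {B. B \<inter> D = {}} {B. B \<inter> \<pi> ` D = {}}"
    by (rule bij_betw_image_Collect[OF assms]) (simp flip: image_Int[OF inj])
  then show ?thesis
    unfolding lower_def card by (simp add: sum.reindex_bij_betw[symmetric])
qed

lemma raise_uminus: "raise i k (\<lambda>D. - E D) B = - raise i k E B"
  by (simp add: raise_def sum_negf)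

lemma lower_uminus: "lower i (\<lambda>B. - F B) D = - lower i F D"
  by (simp add: lower_def sum_negf)

text \<open>The map commutes with permutations, so it passes the symmetries of \<open>E\<close>
  on.\<close>

lemma skew_raise:
  assumes "skew i h j E"
  shows "skew i h j (raise m k E)"
  by (rule skewI)
    (simp_all add: raise_image permutes_bij skew_transpose[OF assms] skew_permutes[OF assms] raise_uminus)

lemma skew_lower:
  assumes "skew i h j F"
  shows "skew i h j (lower m F)"
  by (rule skewI)
    (simp_all add: lower_image permutes_bij skew_transpose[OF assms] skew_permutes[OF assms] lower_uminus)

text \<open>Both sides are skew of degree \<open>i + p\<close>, so they are compared at the union of
  \<open>H\<close> and \<open>C\<close>. A set \<open>D\<close> inside it contains no
  \<open>j c\<close>, so a nonzero sign forces \<open>H\<close> into \<open>D\<close>, and the size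
  leaves only \<open>D = H\<close>, contributing 1.\<close>

lemma raise_pair_coeff:
  fixes h :: "nat \<Rightarrow> 'n::finite"
  assumes pair: "pairing i h j" and p: "p \<le> card (unpaired i h j)"
  shows "raise i (i + p) (pair_coeff i 0 h j) B = pair_coeff i p h j B"
proof -
  let ?F = "raise i (i + p) (pair_coeff i 0 h j)" and ?H = "h ` {..<i}"
  obtain C where C: "C \<subseteq> unpaired i h j" "card C = p"
    using obtain_subset_with_card_n[OF p] by blast
  have H: "card ?H = i" using pair by (simp add: pairing_def card_image)
  have D: "D = ?H" if "D \<subseteq> ?H \<union> C" "card D = i" "pair_sign i h j D \<noteq> 0" for D
  proof -
    have "j c \<notin> D" if "c < i" for c
      using that \<open>D \<subseteq> ?H \<union> C\<close> C(1) pairing_notin(2)[OF pair that] unfolding unpaired_def by blast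
    then have "?H \<subseteq> D"
      using \<open>pair_sign i h j D \<noteq> 0\<close> by (auto simp: pair_sign_nonzero)
    then show ?thesis using H \<open>card D = i\<close> by (intro card_subset_eq[symmetric]) auto
  qed
  have "(\<Sum>D | D \<subseteq> ?H \<union> C \<and> card D = i. pair_coeff i 0 h j D) = (\<Sum>D\<in>{?H}. pair_coeff i 0 h j D)"
    using H D by (intro sum.mono_neutral_right) (auto simp: pair_coeff_def)
  also have "\<dots> = 1" using pair_coeff_top[OF pair, of "{}" 0] by simp
  finally have "?F (?H \<union> C) = 1"
  proof -
    have "?H \<inter> C = {}" using C by (auto simp: unpaired_def)
    then have "card (?H \<union> C) = i + p" using H C by (simp add: card_Un_disjoint)
    moreover assume "(\<Sum>D | D \<subseteq> ?H \<union> C \<and> card D = i. pair_coeff i 0 h j D) = 1"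
    ultimately show ?thesis by (simp add: raise_def)
  qed
  moreover have "card A = i + p" if "?F A \<noteq> 0" for A
    using that by (auto simp: raise_def)
  ultimately show ?thesis
    using skew_eq_pair_coeff[OF pair skew_raise[OF skew_pair_coeff[OF pair]] _ C, of "i" "i + p" 0 B]
    by simp
qed

text \<open>By skewness it suffices to evaluate at \<open>H\<close>. The sets disjoint from
  \<open>H\<close> with nonzero coefficient are the unions of \<open>J\<close> with a
  \<open>p\<close>-subset of the unpaired elements; each contributes the sign of \<open>i\<close>
  factors -1, and the binomial coefficient counts them.\<close>

lemma lower_pair_coeff:
  fixes h :: "nat \<Rightarrow> 'n::finite"
  assumes pair: "pairing i h j"
  shows "lower i (pair_coeff i p h j) D =
    (-1) ^ i * of_nat ((CARD('n) - 2 * i) choose p) * pair_coeff i 0 h j D"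
proof -
  let ?F = "lower i (pair_coeff i p h j)" and ?H = "h ` {..<i}" and ?J = "j ` {..<i}"
  let ?L = "unpaired i h j"
  have J: "card ?J = i" and H: "card ?H = i"
    using pair by (simp_all add: pairing_def card_image)
  have "(\<Sum>B | B \<inter> ?H = {}. pair_coeff i p h j B) =
      (\<Sum>B\<in>(\<union>) ?J ` {C. C \<subseteq> ?L \<and> card C = p}. pair_coeff i p h j B)"
  proof (rule sum.mono_neutral_right)
    show "(\<union>) ?J ` {C. C \<subseteq> ?L \<and> card C = p} \<subseteq> {B. B \<inter> ?H = {}}"
      using pair by (auto simp: unpaired_def pairing_def)
    show "\<forall>B\<in>{B. B \<inter> ?H = {}} - (\<union>) ?J ` {C. C \<subseteq> ?L \<and> card C = p}. pair_coeff i p h j B = 0"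
    proof (rule ballI, rule ccontr)
      fix B assume B: "B \<in> {B. B \<inter> ?H = {}} - (\<union>) ?J ` {C. C \<subseteq> ?L \<and> card C = p}"
        and "pair_coeff i p h j B \<noteq> 0"
      then have "pair_sign i h j B \<noteq> 0" and card: "card B = i + p"
        by (auto simp: pair_coeff_def)
      then have JB: "?J \<subseteq> B"
        using B by (auto simp: pair_sign_nonzero)
      then have "card (B - ?J) = p" using J card by (simp add: card_Diff_subset)
      moreover have "B - ?J \<subseteq> ?L" using B by (auto simp: unpaired_def)
      moreover have "B = ?J \<union> (B - ?J)" using JB by auto
      ultimately show False using B by blast
    qed
  qed simp
  also have "\<dots> = (\<Sum>C | C \<subseteq> ?L \<and> card C = p. pair_coeff i p h j (?J \<union> C))"
  proof (rule sum.reindex_cong[where l = "(\<union>) ?J"])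
    show "inj_on ((\<union>) ?J) {C. C \<subseteq> ?L \<and> card C = p}"
      by (rule inj_on_inverseI[where g = "\<lambda>B. B - ?J"]) (auto simp: unpaired_def)
  qed simp_all
  also have "\<dots> = (\<Sum>C | C \<subseteq> ?L \<and> card C = p. (-1) ^ i)"
  proof (rule sum.cong[OF refl])
    fix C assume C: "C \<in> {C. C \<subseteq> ?L \<and> card C = p}"
    then have "?J \<inter> C = {}" by (auto simp: unpaired_def)
    then have "card (?J \<union> C) = i + p" using C J by (simp add: card_Un_disjoint)
    moreover have "h c \<notin> ?J \<union> C" "j c \<in> ?J \<union> C" if "c < i" for c
      using C that pairing_notin(1)[OF pair that] by (auto simp: unpaired_def)
    ultimately show "pair_coeff i p h j (?J \<union> C) = (-1) ^ i"
      by (simp add: pair_coeff_def pair_sign_def)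
  qed
  also have "\<dots> = (-1) ^ i * of_nat ((CARD('n) - 2 * i) choose p)"
    by (simp add: n_subsets card_unpaired[OF pair])
  finally have "?F ?H = (-1) ^ i * of_nat ((CARD('n) - 2 * i) choose p)"
    by (simp add: lower_def H)
  moreover have "card A = i + 0" if "?F A \<noteq> 0" for A
    using that by (auto simp: lower_def)
  ultimately show ?thesis
    using skew_eq_pair_coeff[OF pair skew_lower[OF skew_pair_coeff[OF pair]], of i p 0 "{}" D]
    by simp
qed

section \<open>The generators\<close>

text \<open>Induction on the number \<open>m\<close> of factors while \<open>L\<close> stays fixed
  for all \<open>i\<close> pairs. Pairs not yet multiplied in lie outside the support, which is why
  the subset condition is carried along; at \<open>m = i\<close> it becomes vacuous.\<close>

lemma sf_coeff_generator_aux: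
  fixes h :: "nat \<Rightarrow> 'n::finite"
  assumes pair: "pairing i h j" and "m \<le> i"
  defines "L \<equiv> unpaired i h j"
  shows "sf_coeff ((\<Prod>c<m. sf_var (h c) - sf_var (j c)) * sf_sigma p L) A =
    pair_sign m h j A * of_bool (card A = m + p \<and> A \<subseteq> h ` {..<m} \<union> j ` {..<m} \<union> L)"
  using \<open>m \<le> i\<close>
proof (induction m arbitrary: A)
  case 0
  then show ?case by (auto simp: sf_coeff_sigma pair_sign_def)
next
  case (Suc m)
  let ?u = "(\<Prod>c<m. sf_var (h c) - sf_var (j c)) * sf_sigma p L"
  let ?X = "\<lambda>m. h ` {..<m} \<union> j ` {..<m} \<union> L"
  have m: "m < i" using Suc by simp
  have "h m \<noteq> h d" "j m \<noteq> j d" "h m \<noteq> j d" "h d \<noteq> j m" if "d < m" for d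
    using that m pairing_neq[OF pair m, of d] pairing_neq(1)[OF pair _ m, of d] by auto
  \<comment> \<open>The variables of the new factor do not occur in the partial product.\<close>
  then have notin: "h m \<notin> ?X m" "j m \<notin> ?X m" "h m \<noteq> j m"
    using m pairing_neq(1)[OF pair m m]
    unfolding L_def unpaired_def image_def by (simp_all, (metis lessThan_iff)+)
  have sign: "pair_sign m h j (A - {x}) = pair_sign m h j A" if "x \<notin> ?X m" for x
    unfolding pair_sign_def using that by (intro prod.cong) auto
  have IH: "sf_coeff ?u A = pair_sign m h j A * of_bool (card A = m + p \<and> A \<subseteq> ?X m)" for A
    using Suc by simp
  have "sf_coeff ((sf_var (h m) - sf_var (j m)) * ?u) A =
      sf_coeff (sf_var (h m) * ?u) A - sf_coeff (sf_var (j m) * ?u) A"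
    by (simp add: left_diff_distrib sf_coeff_diff)
  also have "\<dots> = (of_bool (h m \<in> A) - of_bool (j m \<in> A)) *
      (pair_sign m h j A * of_bool (card A = Suc m + p \<and> A \<subseteq> ?X (Suc m)))"
  proof -
    have X: "?X (Suc m) = insert (h m) (insert (j m) (?X m))"
      by (auto simp: lessThan_Suc)
    have card: "card (A - {x}) = m + p \<longleftrightarrow> card A = Suc m + p" if "x \<in> A" for x
      using card.remove[OF finite that] by linarith
    have subset: "A - {x} \<subseteq> ?X m \<longleftrightarrow> A \<subseteq> insert x (?X m)" for x
      by blast
    \<comment> \<open>If \<open>A\<close> contains both new elements, removing one leaves the other,
      which is outside the old support, so both terms vanish, matching 1 - 1. If it contains
      neither, both vanish as well.\<close>
    show ?thesis
      unfolding sf_coeff_var_mult IH sign[OF notin(1)] sign[OF notin(2)] X subset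
      using notin by (cases "h m \<in> A"; cases "j m \<in> A") (auto simp: card of_bool_def simp del: card_Diff_insert card_Diff_singleton)
  qed
  finally show ?case by (simp add: mult_ac pair_sign_def)
qed

lemma sf_coeff_generator:
  fixes h :: "nat \<Rightarrow> 'n::finite"
  assumes "pairing i h j"
  shows "sf_coeff ((\<Prod>c<i. sf_var (h c) - sf_var (j c)) * sf_sigma p (unpaired i h j)) A =
    pair_coeff i p h j A"
proof -
  have "A \<subseteq> h ` {..<i} \<union> j ` {..<i} \<union> unpaired i h j" by (auto simp: unpaired_def)
  then show ?thesis
    using sf_coeff_generator_aux[OF assms order_refl, of p A] by (simp add: pair_coeff_def)
qed

text \<open>These are the polynomials of the theorem with \<open>p\<close> for \<open>k - i\<close>,
  so that the degree is \<open>i + p\<close> and truncated subtraction is avoided.\<close>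

definition sf_generators :: "nat \<Rightarrow> nat \<Rightarrow> 'n::{finite, linorder} sf set"
  where "sf_generators i p = {sf_Delta hs js * sf_sigma p L |hs js L.
    length hs = i \<and> length js = i \<and> distinct (hs @ js) \<and> (\<forall>\<alpha> < i. hs ! \<alpha> < js ! \<alpha>) \<and>
    set hs \<union> set js \<union> L = UNIV \<and> L \<inter> (set hs \<union> set js) = {}}"

lemma set_nth: "length xs = i \<Longrightarrow> set xs = (!) xs ` {..<i}"
  by (auto simp: set_conv_nth)

lemma sf_generators_pairing:
  assumes "g \<in> sf_generators i p"
  obtains h j where "pairing i h j" "g = sf_of (pair_coeff i p h j)"
proof -
  from assms obtain hs js L where g: "g = sf_Delta hs js * sf_sigma p L"
    and len: "length hs = i" "length js = i" and dist: "distinct (hs @ js)"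
    and L: "set hs \<union> set js \<union> L = UNIV" "L \<inter> (set hs \<union> set js) = {}"
    unfolding sf_generators_def by blast
  have pair: "pairing i ((!) hs) ((!) js)"
    using dist len by (simp add: pairing_def inj_on_nth flip: set_nth)
  have "L = unpaired i ((!) hs) ((!) js)"
    using L len by (auto simp: unpaired_def simp flip: set_nth)
  then have "g = (\<Prod>c<i. sf_var (hs ! c) - sf_var (js ! c)) * sf_sigma p (unpaired i ((!) hs) ((!) js))"
    by (simp add: g sf_Delta_def len)
  then have "g = sf_of (pair_coeff i p ((!) hs) ((!) js))"
    using sf_coeff_generator[OF pair] by (intro sf_eqI) (simp add: sf_coeff_of)
  with pair that show thesis by blast
qed

text \<open>Sorting each pair into minimum and maximum yields a genuine generator. Every exchanged
  pair flips the sign of its factor, and \<open>s\<close> collects these signs.\<close>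

lemma sf_of_pair_coeff_in_span:
  fixes h :: "nat \<Rightarrow> 'n::{finite, linorder}"
  assumes pair: "pairing i h j"
  shows "sf_of (pair_coeff i p h j) \<in> sf.span (sf_generators i p)"
proof -
  define h' where "h' c = min (h c) (j c)" for c
  define j' where "j' c = max (h c) (j c)" for c
  define s where "s = (\<Prod>c<i. if h c < j c then 1 else -1 :: rat)"
  have pair': "pairing i h' j'"
    unfolding pairing_def
  proof (intro conjI)
    show "inj_on h' {..<i}" "inj_on j' {..<i}"
      using pairing_neq[OF pair] pairing_neq(1)[OF pair, symmetric]
      by (auto simp: inj_on_def h'_def j'_def min_def max_def split: if_splits)
    show "h' ` {..<i} \<inter> j' ` {..<i} = {}"
      using pairing_neq[OF pair] pairing_neq(1)[OF pair, symmetric]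
      by (auto simp: h'_def j'_def min_def max_def split: if_splits)
  qed
  have un: "h' ` {..<i} \<union> j' ` {..<i} = h ` {..<i} \<union> j ` {..<i}"
  proof -
    have "{h' c, j' c} = {h c, j c}" for c by (auto simp: h'_def j'_def min_def max_def)
    moreover have "f ` {..<i} \<union> g ` {..<i} = (\<Union>c<i. {f c, g c})" for f g :: "nat \<Rightarrow> 'n" by auto
    ultimately show ?thesis by simp
  qed
  let ?hs = "map h' [0..<i]" and ?js = "map j' [0..<i]"
  let ?g = "sf_Delta ?hs ?js * sf_sigma p (unpaired i h' j')"
  have set: "set ?hs = h' ` {..<i}" "set ?js = j' ` {..<i}" by (auto simp: lessThan_atLeast0)
  have "?g \<in> sf_generators i p"
  proof -
    have "distinct (?hs @ ?js)"
      using pair' by (simp add: distinct_map pairing_def lessThan_atLeast0)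
    moreover have "\<forall>\<alpha><i. ?hs ! \<alpha> < ?js ! \<alpha>"
      using pairing_neq(1)[OF pair] by (auto simp: h'_def j'_def min_def max_def not_le order.strict_iff_order)
    moreover have "set ?hs \<union> set ?js \<union> unpaired i h' j' = UNIV"
      "unpaired i h' j' \<inter> (set ?hs \<union> set ?js) = {}"
      unfolding set by (auto simp: unpaired_def)
    ultimately show ?thesis
      unfolding sf_generators_def
      by (intro CollectI exI[of _ ?hs] exI[of _ ?js] exI[of _ "unpaired i h' j'"] conjI) simp_all
  qed
  moreover have "sf_of (pair_coeff i p h j) = sf_scale s ?g"
  proof (rule sf_eqI)
    fix A
    have "?g = (\<Prod>c<i. sf_var (h' c) - sf_var (j' c)) * sf_sigma p (unpaired i h' j')"
      by (simp add: sf_Delta_def)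
    then have "sf_coeff ?g A = pair_coeff i p h' j' A"
      using sf_coeff_generator[OF pair'] by simp
    moreover have "pair_sign i h j A = s * pair_sign i h' j' A"
      unfolding pair_sign_def s_def prod.distrib[symmetric]
      by (intro prod.cong) (auto simp: h'_def j'_def min_def max_def)
    ultimately show "sf_coeff (sf_of (pair_coeff i p h j)) A = sf_coeff (sf_scale s ?g) A"
      by (simp add: sf_coeff_of sf_coeff_scale pair_coeff_def)
  qed
  ultimately show ?thesis by (simp add: sf.span_base sf.span_scale)
qed

section \<open>The span of the generators as a homogeneous submodule\<close>

lemma sf_act_pair_coeff:
  fixes h :: "nat \<Rightarrow> 'n::finite"
  assumes "\<pi> permutes UNIV"
  shows "sf_act \<pi> (sf_of (pair_coeff i p h j)) = sf_of (pair_coeff i p (\<pi> \<circ> h) (\<pi> \<circ> j))"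
proof (rule sf_eqI)
  fix A
  have bij: "bij \<pi>" using assms by (rule permutes_bij)
  then have inj: "inj \<pi>" by (rule bij_is_inj)
  obtain B where A: "A = \<pi> ` B" using bij by (metis bij_is_surj subset_UNIV subset_image_iff)
  show "sf_coeff (sf_act \<pi> (sf_of (pair_coeff i p h j))) A =
      sf_coeff (sf_of (pair_coeff i p (\<pi> \<circ> h) (\<pi> \<circ> j))) A"
    by (simp add: A sf_coeff_act[OF bij] sf_coeff_of pair_coeff_def pair_sign_def
        inj_image_mem_iff[OF inj] card_image inj_on_subset[OF inj])
qed

lemma pairing_comp: "inj \<pi> \<Longrightarrow> pairing i h j \<Longrightarrow> pairing i (\<pi> \<circ> h) (\<pi> \<circ> j)"
  unfolding pairing_def
  by (metis comp_inj_on image_Int image_comp image_empty inj_on_subset subset_UNIV)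

text \<open>A permutation sends pairings to pairings but may break the order inside pairs, so
  generators are mapped into the span rather than to generators.\<close>

lemma sf_submodule_span_generators:
  "sf_submodule (sf.span (sf_generators i p :: 'n::{finite, linorder} sf set))"
  unfolding sf_submodule_def
proof (intro conjI allI impI ballI)
  show "sf.subspace (sf.span (sf_generators i p :: 'n sf set))" by (rule sf.subspace_span)
  fix \<pi> :: "'n \<Rightarrow> 'n" and u :: "'n sf"
  assume \<pi>: "\<pi> permutes UNIV" and "u \<in> sf.span (sf_generators i p)"
  from this(2) show "sf_act \<pi> u \<in> sf.span (sf_generators i p)"
  proof (induction u rule: sf.span_induct_alt)
    case base
    show ?case by (simp add: sf_act_zero sf.span_zero)
  next
    case (step c g y)
    obtain h j where hj: "pairing i h j" "g = sf_of (pair_coeff i p h j)"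
      using step(1) by (rule sf_generators_pairing)
    have "sf_act \<pi> g \<in> sf.span (sf_generators i p)"
      using hj \<pi> by (simp add: sf_act_pair_coeff sf_of_pair_coeff_in_span pairing_comp permutes_inj)
    then show ?case using step(2) by (simp add: sf_act_add sf_act_scale sf.span_add sf.span_scale)
  qed
qed

lemma subspace_sf_deg: "sf.subspace (sf_deg k :: 'n::finite sf set)"
  by (rule sf.subspaceI) (auto simp: sf_deg_iff sf_coeff_zero sf_coeff_add sf_coeff_scale, metis add.left_neutral)

lemma span_generators_sf_deg:
  "sf.span (sf_generators i p :: 'n::{finite, linorder} sf set) \<subseteq> sf_deg (i + p)"
proof (rule sf.span_minimal[OF _ subspace_sf_deg], rule subsetI)
  fix g :: "'n sf" assume "g \<in> sf_generators i p"
  then obtain h j where "g = sf_of (pair_coeff i p h j)" by (rule sf_generators_pairing)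
  then show "g \<in> sf_deg (i + p)" by (auto simp: sf_deg_iff sf_coeff_of pair_coeff_def)
qed

section \<open>Polytabloids of two-row shape\<close>

text \<open>The tabloid of two-row shape with second row \<open>D\<close>, in the encoding by row
  numbers used for \<open>tab_row\<close>.\<close>

definition row_of :: "'n set \<Rightarrow> 'n \<Rightarrow> nat"
  where "row_of D x = of_bool (x \<in> D)"

lemma row_of_eq_iff: "row_of D = row_of D' \<longleftrightarrow> D = D'"
  by (auto simp: row_of_def fun_eq_iff of_bool_eq_iff)

lemma row_of_image: "inj \<pi> \<Longrightarrow> row_of (\<pi> ` D) \<circ> \<pi> = row_of D"
  by (auto simp: row_of_def fun_eq_iff inj_image_mem_iff)

lemma lookup_tbl_act:
  assumes "bij \<pi>"
  shows "Poly_Mapping.lookup (tbl_act \<pi> v) t = Poly_Mapping.lookup v (t \<circ> \<pi>)"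
proof -
  have eq: "s \<circ> inv \<pi> = t \<longleftrightarrow> s = t \<circ> \<pi>" for s
    using assms by (metis bij_is_inj bij_is_surj comp_assoc comp_id inj_iff surj_iff)
  show ?thesis
    by (simp add: tbl_act_def lookup_sum lookup_single when_def eq in_keys_iff)
qed

text \<open>The tabloid with second row \<open>D\<close> of size \<open>i\<close> goes to the sum of
  the monomials of all \<open>k\<close>-sets containing \<open>D\<close>. The map is defined on all
  formal combinations, other row functions being sent to 0.\<close>

definition raise_tabloids :: "nat \<Rightarrow> nat \<Rightarrow> 'n::finite tabloids \<Rightarrow> 'n sf"
  where "raise_tabloids i k v = sf_of (raise i k (\<lambda>D. Poly_Mapping.lookup v (row_of D)))"

lemma sf_coeff_raise_tabloids:
  "sf_coeff (raise_tabloids i k v) = raise i k (\<lambda>D. Poly_Mapping.lookup v (row_of D))"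
  by (simp add: raise_tabloids_def sf_coeff_of fun_eq_iff)

lemma raise_tabloids_add:
  "raise_tabloids i k (u + v) = raise_tabloids i k u + raise_tabloids i k v"
  by (rule sf_eqI)
    (simp add: sf_coeff_raise_tabloids sf_coeff_add raise_def lookup_add sum.distrib distrib_left)

lemma raise_tabloids_scale:
  "raise_tabloids i k (tbl_scale c v) = sf_scale c (raise_tabloids i k v)"
  by (rule sf_eqI)
    (simp add: sf_coeff_raise_tabloids sf_coeff_scale raise_def lookup_tbl_scale mult_ac
      flip: sum_distrib_left)

lemma raise_tabloids_act:
  assumes "\<pi> permutes UNIV"
  shows "raise_tabloids i k (tbl_act \<pi> v) = sf_act \<pi> (raise_tabloids i k v)"
proof (rule sf_eqI)
  fix A
  have bij: "bij \<pi>" using assms by (rule permutes_bij)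
  obtain B where A: "A = \<pi> ` B" using bij by (metis bij_is_surj subset_UNIV subset_image_iff)
  show "sf_coeff (raise_tabloids i k (tbl_act \<pi> v)) A = sf_coeff (sf_act \<pi> (raise_tabloids i k v)) A"
    by (simp add: A sf_coeff_act[OF bij] sf_coeff_raise_tabloids raise_image[OF bij]
        lookup_tbl_act[OF bij] row_of_image[OF bij_is_inj[OF bij]])
qed

text \<open>Such a tableau has \<open>i\<close> columns of length two, with entries
  \<open>hi c\<close> above \<open>lo c\<close>, and all its other columns have length one. The
  bound makes the shape a partition; \<open>lo\<close> and \<open>hi\<close> form a pairing whose
  unpaired elements are the entries of the short columns.\<close>

locale two_row_tableau =
  fixes i :: nat and T :: "nat \<times> nat \<Rightarrow> 'n::finite"
  assumes double_le: "2 * i \<le> CARD('n)" and tab: "tableau [CARD('n) - i, i] T"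
begin

abbreviation "lo c \<equiv> T (Suc 0, c)"
abbreviation "hi c \<equiv> T (0, c)"
abbreviation "poly_tab \<equiv> polytabloid [CARD('n) - i, i] T"

lemma cells_shape: "(r, c) \<in> cells [CARD('n) - i, i] \<longleftrightarrow> r = 0 \<and> c < CARD('n) - i \<or> r = Suc 0 \<and> c < i"
  by (auto simp: cells_def less_Suc_eq numeral_2_eq_2)

lemma inv_T: "x \<in> cells [CARD('n) - i, i] \<Longrightarrow> inv_into (cells [CARD('n) - i, i]) T (T x) = x"
  using tab by (simp add: tableau_def bij_betw_def)

lemma tab_row_T: "(r, c) \<in> cells [CARD('n) - i, i] \<Longrightarrow> tab_row [CARD('n) - i, i] T (T (r, c)) = r"
  by (simp add: tab_row_def inv_T)

lemma tab_col_T: "(r, c) \<in> cells [CARD('n) - i, i] \<Longrightarrow> tab_col [CARD('n) - i, i] T (T (r, c)) = c"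
  by (simp add: tab_col_def inv_T)

lemma T_row_col: "(tab_row [CARD('n) - i, i] T x, tab_col [CARD('n) - i, i] T x) \<in> cells [CARD('n) - i, i]"
  "T (tab_row [CARD('n) - i, i] T x, tab_col [CARD('n) - i, i] T x) = x"
proof -
  have x: "x \<in> T ` cells [CARD('n) - i, i]" using tab by (auto simp: tableau_def bij_betw_def)
  show "(tab_row [CARD('n) - i, i] T x, tab_col [CARD('n) - i, i] T x) \<in> cells [CARD('n) - i, i]"
    using inv_into_into[OF x] by (simp add: tab_row_def tab_col_def)
  show "T (tab_row [CARD('n) - i, i] T x, tab_col [CARD('n) - i, i] T x) = x"
    using f_inv_into_f[OF x] by (simp add: tab_row_def tab_col_def)
qed

lemma pairing: "pairing i lo hi"
proof -
  have "inj_on T (cells [CARD('n) - i, i])" using tab by (simp add: tableau_def bij_betw_def)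
  then have "T x = T y \<longleftrightarrow> x = y" if "x \<in> cells [CARD('n) - i, i]" "y \<in> cells [CARD('n) - i, i]" for x y
    using that by (simp add: inj_on_eq_iff)
  then show ?thesis
    using double_le by (auto simp: pairing_def inj_on_def cells_shape)
qed

lemma tab_row_eq: "tab_row [CARD('n) - i, i] T = row_of (lo ` {..<i})"
proof
  fix x
  obtain r c where x: "x = T (r, c)" and rc: "(r, c) \<in> cells [CARD('n) - i, i]"
    using T_row_col[of x] by metis
  have "x \<in> lo ` {..<i} \<longleftrightarrow> r = 1"
    using rc tab_row_T[OF rc] tab_row_T[of "Suc 0"] unfolding x by (auto simp: cells_shape)
  then show "tab_row [CARD('n) - i, i] T x = row_of (lo ` {..<i}) x"
    using rc by (auto simp: x tab_row_T row_of_def cells_shape)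
qed

lemma unpaired_col:
  assumes "x \<in> unpaired i lo hi"
  shows "tab_row [CARD('n) - i, i] T x = 0" "i \<le> tab_col [CARD('n) - i, i] T x"
proof -
  obtain r c where x: "x = T (r, c)" and rc: "(r, c) \<in> cells [CARD('n) - i, i]"
    using T_row_col[of x] by metis
  have "r = 0 \<and> i \<le> c"
    using assms rc by (auto simp: x cells_shape unpaired_def not_less)
  then show "tab_row [CARD('n) - i, i] T x = 0" "i \<le> tab_col [CARD('n) - i, i] T x"
    using rc by (simp_all add: x tab_row_T tab_col_T)
qed

abbreviation "stab \<equiv> col_stabilizer [CARD('n) - i, i] T"

lemma stab_permutes: "\<tau> \<in> stab \<Longrightarrow> \<tau> permutes UNIV"
  by (simp add: col_stabilizer_def)

lemma stab_col: "\<tau> \<in> stab \<Longrightarrow> tab_col [CARD('n) - i, i] T (\<tau> x) = tab_col [CARD('n) - i, i] T x"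
  by (simp add: col_stabilizer_def)

lemma id_stab: "id \<in> stab"
  by (simp add: col_stabilizer_def permutes_id)

lemma stab_comp: "\<sigma> \<in> stab \<Longrightarrow> \<tau> \<in> stab \<Longrightarrow> \<sigma> \<circ> \<tau> \<in> stab"
  by (simp add: col_stabilizer_def permutes_compose)

lemma transpose_stab:
  assumes "c < i"
  shows "transpose (lo c) (hi c) \<in> stab"
proof -
  have "tab_col [CARD('n) - i, i] T (lo c) = c" "tab_col [CARD('n) - i, i] T (hi c) = c"
    using assms double_le by (simp_all add: tab_col_T cells_shape)
  then show ?thesis
    by (simp add: col_stabilizer_def permutes_swap_id) (simp add: transpose_def)
qed

text \<open>The image of \<open>x\<close> stays in a column with index at least \<open>i\<close>,
  and such a column has only its cell in the first row.\<close>

lemma stab_unpaired: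
  assumes "\<tau> \<in> stab" "x \<in> unpaired i lo hi"
  shows "\<tau> x = x"
proof -
  have "tab_row [CARD('n) - i, i] T (\<tau> x) = 0"
    using T_row_col(1)[of "\<tau> x"] unpaired_col(2)[OF assms(2)] by (auto simp: stab_col[OF assms(1)] cells_shape)
  then show ?thesis
    using T_row_col(2)[of "\<tau> x"] T_row_col(2)[of x] unpaired_col(1)[OF assms(2)]
    by (simp add: stab_col[OF assms(1)])
qed

lemma tab_row_comp:
  assumes "\<tau> permutes UNIV"
  shows "tab_row [CARD('n) - i, i] (\<tau> \<circ> T) = tab_row [CARD('n) - i, i] T \<circ> inv \<tau>"
proof
  fix x
  have inj: "inj_on (\<tau> \<circ> T) (cells [CARD('n) - i, i])"
    using tab assms by (auto simp: tableau_def bij_betw_def intro!: comp_inj_on permutes_inj_on)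
  define y where "y = (tab_row [CARD('n) - i, i] T (inv \<tau> x), tab_col [CARD('n) - i, i] T (inv \<tau> x))"
  have "(\<tau> \<circ> T) y = x"
    using T_row_col(2)[of "inv \<tau> x"] permutes_inverses(1)[OF assms] by (simp add: y_def)
  then have "inv_into (cells [CARD('n) - i, i]) (\<tau> \<circ> T) x = y"
    using inv_into_f_eq[OF inj] T_row_col(1)[of "inv \<tau> x"] by (simp add: y_def)
  then show "tab_row [CARD('n) - i, i] (\<tau> \<circ> T) x = (tab_row [CARD('n) - i, i] T \<circ> inv \<tau>) x"
    by (simp add: tab_row_def[of _ "\<tau> \<circ> T"] y_def)
qed

lemma lookup_poly_tab:
  "Poly_Mapping.lookup poly_tab t =
    (\<Sum>\<tau>\<in>stab. if tab_row [CARD('n) - i, i] T \<circ> inv \<tau> = t then of_int (sign \<tau>) else 0)"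
  unfolding polytabloid_def lookup_sum
  by (intro sum.cong) (simp_all add: lookup_single when_def tab_row_comp stab_permutes)

text \<open>Composition with the swap is a self-inverse bijection of the column stabilizer that
  reverses signs, so reindexing the sum along it negates the coefficient.\<close>

lemma poly_tab_transpose:
  assumes "c < i"
  shows "Poly_Mapping.lookup poly_tab (t \<circ> transpose (lo c) (hi c)) = - Poly_Mapping.lookup poly_tab t"
proof -
  let ?s = "transpose (lo c) (hi c)"
  let ?r = "tab_row [CARD('n) - i, i] T"
  have s: "?s \<in> stab" using assms by (rule transpose_stab)
  have ss: "?s \<circ> (?s \<circ> \<tau>) = \<tau>" for \<tau> :: "'n \<Rightarrow> 'n" by (simp add: fun_eq_iff)
  have neq: "lo c \<noteq> hi c" using pairing_neq(1)[OF pairing assms assms] .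
  have eq: "?r \<circ> inv (?s \<circ> \<tau>) = t \<longleftrightarrow> ?r \<circ> inv \<tau> = t \<circ> ?s" if "\<tau> \<in> stab" for \<tau>
  proof -
    have "inv (?s \<circ> \<tau>) = inv \<tau> \<circ> ?s"
      using permutes_bij[OF stab_permutes[OF that]] by (simp add: o_inv_distrib)
    moreover have "f \<circ> ?s = t \<longleftrightarrow> f = t \<circ> ?s" for f by (auto simp: fun_eq_iff) (metis transpose_involutory)+
    ultimately show ?thesis by (simp add: comp_assoc[symmetric])
  qed
  have sign: "sign (?s \<circ> \<tau>) = - sign \<tau>" if "\<tau> \<in> stab" for \<tau>
    using sign_compose[of ?s \<tau>] neq permutes_imp_permutation[OF finite stab_permutes[OF that]]
    by (simp add: sign_swap_id permutation_swap_id)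
  have "Poly_Mapping.lookup poly_tab t =
      (\<Sum>\<tau>\<in>stab. if ?r \<circ> inv (?s \<circ> \<tau>) = t then of_int (sign (?s \<circ> \<tau>)) else 0)"
    unfolding lookup_poly_tab
    by (rule sum.reindex_bij_witness[of _ "\<lambda>\<tau>. ?s \<circ> \<tau>" "\<lambda>\<tau>. ?s \<circ> \<tau>"])
      (simp_all only: ss stab_comp[OF s])
  also have "\<dots> = (\<Sum>\<tau>\<in>stab. - (if ?r \<circ> inv \<tau> = t \<circ> ?s then of_int (sign \<tau>) else 0))"
    by (intro sum.cong) (simp_all add: eq sign)
  also have "\<dots> = - Poly_Mapping.lookup poly_tab (t \<circ> ?s)"
    by (simp add: lookup_poly_tab sum_negf)
  finally show ?thesis by simp
qed

lemma poly_tab_permutes: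
  assumes \<pi>: "\<pi> permutes unpaired i lo hi"
  shows "Poly_Mapping.lookup poly_tab (t \<circ> \<pi>) = Poly_Mapping.lookup poly_tab t"
  unfolding lookup_poly_tab
proof (intro sum.cong refl)
  fix \<tau> assume \<tau>: "\<tau> \<in> stab"
  let ?f = "tab_row [CARD('n) - i, i] T \<circ> inv \<tau>"
  have inv: "inv \<tau> x = x" if "x \<in> unpaired i lo hi" for x
    using stab_unpaired[OF \<tau> that] permutes_inverses(2)[OF stab_permutes[OF \<tau>], of x] by simp
  \<comment> \<open>The row function of each tabloid in the polytabloid is 0 on all unpaired
    entries, because \<tau> fixes them. Hence \<pi>, which moves only these entries, does not change
    it.\<close>
  have f: "?f \<circ> \<pi> = ?f"
  proof
    fix x show "(?f \<circ> \<pi>) x = ?f x"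
    proof (cases "x \<in> unpaired i lo hi")
      case True
      moreover have "\<pi> x \<in> unpaired i lo hi" using \<pi> True by (simp add: permutes_in_image)
      ultimately show ?thesis by (simp add: inv unpaired_col)
    qed (simp add: permutes_not_in[OF \<pi>])
  qed
  have "?f = t \<circ> \<pi> \<longleftrightarrow> ?f = t"
  proof
    assume "?f = t \<circ> \<pi>"
    with f have "?f \<circ> \<pi> = t \<circ> \<pi>" by (rule trans)
    then have "(?f \<circ> \<pi>) \<circ> inv \<pi> = (t \<circ> \<pi>) \<circ> inv \<pi>" by (rule arg_cong)
    then show "?f = t" by (simp only: comp_assoc permutes_inv_o[OF \<pi>] comp_id)
  next
    assume "?f = t"
    then show "?f = t \<circ> \<pi>" using f by (simp only:)
  qed
  then show "(if ?f = t \<circ> \<pi> then of_int (sign \<tau>) else 0) = (if ?f = t then of_int (sign \<tau>) else (0::rat))"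
    by simp
qed

lemma poly_tab_nonzero:
  assumes "Poly_Mapping.lookup poly_tab t \<noteq> 0"
  obtains D where "card D = i" "t = row_of D"
proof -
  obtain \<tau> where \<tau>: "\<tau> \<in> stab" and t: "t = tab_row [CARD('n) - i, i] T \<circ> inv \<tau>"
    using assms unfolding lookup_poly_tab by (auto elim: sum.not_neutral_contains_not_neutral split: if_splits)
  have perm: "\<tau> permutes UNIV" using \<tau> by (rule stab_permutes)
  have "row_of (\<tau> ` (lo ` {..<i})) \<circ> \<tau> \<circ> inv \<tau> = t"
    by (simp only: row_of_image[OF permutes_inj[OF perm]] t tab_row_eq)
  then have "t = row_of (\<tau> ` (lo ` {..<i}))"
    using permutes_surj[OF perm] by (simp add: comp_assoc surj_iff)
  moreover have "card (\<tau> ` (lo ` {..<i})) = i"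
    using pairing permutes_inj_on[OF perm] by (simp add: card_image pairing_def)
  ultimately show thesis using that by blast
qed

text \<open>An entry is determined by its row and column, so a column-preserving permutation that
  also preserves rows is the identity. Only that term contributes.\<close>

lemma poly_tab_top: "Poly_Mapping.lookup poly_tab (row_of (lo ` {..<i})) = 1"
proof -
  let ?r = "tab_row [CARD('n) - i, i] T"
  have id: "\<tau> = id" if \<tau>: "\<tau> \<in> stab" and r: "?r \<circ> inv \<tau> = ?r" for \<tau>
  proof
    fix x
    have "?r (\<tau> x) = ?r x"
      using fun_cong[OF r, of "\<tau> x"] permutes_inverses(2)[OF stab_permutes[OF \<tau>], of x] by simp
    then show "\<tau> x = id x"
      using T_row_col(2)[of "\<tau> x"] T_row_col(2)[of x] by (simp add: stab_col[OF \<tau>])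
  qed
  have "Poly_Mapping.lookup poly_tab ?r = (\<Sum>\<tau>\<in>{id}. if ?r \<circ> inv \<tau> = ?r then of_int (sign \<tau>) else 0)"
    unfolding lookup_poly_tab using id_stab id by (intro sum.mono_neutral_right) auto
  then show ?thesis by (simp add: tab_row_eq)
qed

text \<open>The coefficients are skew, live in degree \<open>i\<close> and equal 1 at the second row
  of \<open>T\<close>. So the polytabloid, read as a square free polynomial, is the difference
  product itself, the case \<open>p = 0\<close> with empty reference set \<open>C\<close>.\<close>

lemma lookup_poly_tab_row_of: "Poly_Mapping.lookup poly_tab (row_of D) = pair_coeff i 0 lo hi D"
proof -
  let ?E = "\<lambda>D. Poly_Mapping.lookup poly_tab (row_of D)"
  have skew: "skew i lo hi ?E"
  proof (rule skewI)
    fix c A assume "c < i"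
    then show "?E (transpose (lo c) (hi c) ` A) = - ?E A"
      using poly_tab_transpose[of c "row_of (transpose (lo c) (hi c) ` A)"]
      by (simp add: row_of_image)
  next
    fix \<pi> A assume "\<pi> permutes unpaired i lo hi"
    then show "?E (\<pi> ` A) = ?E A"
      using poly_tab_permutes[of \<pi> "row_of (\<pi> ` A)"] by (simp add: row_of_image permutes_inj)
  qed
  have "card A = i + 0" if "?E A \<noteq> 0" for A
    using poly_tab_nonzero[OF that] by (metis add_0_right row_of_eq_iff)
  then have "?E D = ?E (lo ` {..<i} \<union> {}) * pair_coeff i 0 lo hi D"
    by (rule skew_eq_pair_coeff[OF pairing skew]) simp_all
  then show ?thesis by (simp add: poly_tab_top)
qed

lemma tbl_act_transpose:
  assumes "c < i"
  shows "tbl_act (transpose (lo c) (hi c)) poly_tab = tbl_scale (-1) poly_tab"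
  by (rule poly_mapping_eqI) (simp add: lookup_tbl_act lookup_tbl_scale poly_tab_transpose[OF assms])

lemma tbl_act_permutes:
  assumes "\<pi> permutes unpaired i lo hi"
  shows "tbl_act \<pi> poly_tab = poly_tab"
  by (rule poly_mapping_eqI)
    (simp add: lookup_tbl_act[OF permutes_bij[OF assms]] poly_tab_permutes[OF assms])

lemma poly_tab_specht: "poly_tab \<in> specht [CARD('n) - i, i]"
  unfolding specht_def using tab by (blast intro: tbl.span_base)

lemma raise_tabloids_poly_tab:
  assumes "2 * i + p \<le> CARD('n)"
  shows "raise_tabloids i (i + p) poly_tab = sf_of (pair_coeff i p lo hi)"
  by (rule sf_eqI)
    (use assms in \<open>simp add: sf_coeff_raise_tabloids lookup_poly_tab_row_of sf_coeff_of
      raise_pair_coeff[OF pairing] card_unpaired[OF pairing]\<close>)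

text \<open>
  The symmetries of the polytabloid determine its image under a homomorphism up to a factor.
\<close>

lemma hom_poly_tab:
  assumes act: "\<And>\<pi> v. \<pi> permutes UNIV \<Longrightarrow> v \<in> specht [CARD('n) - i, i] \<Longrightarrow> \<phi> (tbl_act \<pi> v) = sf_act \<pi> (\<phi> v)"
    and scale: "\<And>c v. v \<in> specht [CARD('n) - i, i] \<Longrightarrow> \<phi> (tbl_scale c v) = sf_scale c (\<phi> v)"
    and deg: "\<phi> poly_tab \<in> sf_deg (i + p)" and p: "2 * i + p \<le> CARD('n)"
  obtains a where "\<phi> poly_tab = sf_scale a (sf_of (pair_coeff i p lo hi))"
proof -
  let ?F = "sf_coeff (\<phi> poly_tab)"
  \<comment> \<open>The bound on \<open>p\<close> provides a reference set \<open>C\<close> at which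
    the scalar can be read off.\<close>
  have "p \<le> card (unpaired i lo hi)" using p by (simp add: card_unpaired[OF pairing])
  then obtain C where C: "C \<subseteq> unpaired i lo hi" "card C = p"
    using obtain_subset_with_card_n by blast
  have skew: "skew i lo hi ?F"
  proof (rule skewI)
    fix c A assume c: "c < i"
    let ?s = "transpose (lo c) (hi c)"
    have "sf_act ?s (\<phi> poly_tab) = sf_scale (-1) (\<phi> poly_tab)"
      using act[of ?s poly_tab] scale[of poly_tab "-1"] poly_tab_specht stab_permutes[OF transpose_stab[OF c]]
      by (simp add: tbl_act_transpose[OF c])
    then show "?F (?s ` A) = - ?F A"
      using sf_coeff_act[of ?s "\<phi> poly_tab" A] sf_coeff_scale[of "-1" "\<phi> poly_tab" "?s ` A"] by simp
  next
    fix \<pi> A assume \<pi>: "\<pi> permutes unpaired i lo hi"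
    have "sf_act \<pi> (\<phi> poly_tab) = \<phi> poly_tab"
      using act[of \<pi> poly_tab] poly_tab_specht permutes_subset[OF \<pi> subset_UNIV]
      by (simp add: tbl_act_permutes[OF \<pi>])
    then show "?F (\<pi> ` A) = ?F A"
      using sf_coeff_act[OF permutes_bij[OF \<pi>], of "\<phi> poly_tab" A] by simp
  qed
  have supp: "card A = i + p" if "?F A \<noteq> 0" for A
    using that deg unfolding sf_deg_iff by blast
  have F: "?F A = ?F (lo ` {..<i} \<union> C) * pair_coeff i p lo hi A" for A
    using supp C by (rule skew_eq_pair_coeff[OF pairing skew])
  have "\<phi> poly_tab = sf_scale (?F (lo ` {..<i} \<union> C)) (sf_of (pair_coeff i p lo hi))"
    by (rule sf_eqI) (simp only: sf_coeff_scale sf_coeff_of F[symmetric])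
  then show thesis by (rule that)
qed

end

text \<open>The pairs fill the columns of length two, with \<open>h\<close> in the second row, and
  any bijection \<open>g\<close> puts the unpaired elements into the rest of the first row. Thus
  every generator will come from a polytabloid.\<close>

lemma pairing_tableau:
  fixes h :: "nat \<Rightarrow> 'n::finite"
  assumes pair: "pairing i h j"
  obtains T where "tableau [CARD('n) - i, i] T" "\<And>c. c < i \<Longrightarrow> T (Suc 0, c) = h c"
    "\<And>c. c < i \<Longrightarrow> T (0, c) = j c"
proof -
  let ?\<mu> = "[CARD('n) - i, i]"
  have "2 * i = card (h ` {..<i} \<union> j ` {..<i})"
    using pair by (simp add: pairing_def card_Un_disjoint card_image)
  then have i: "2 * i \<le> CARD('n)" by (simp add: card_mono)
  have "card {i..<CARD('n) - i} = card (unpaired i h j)"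
    by (simp add: card_unpaired[OF pair])
  then obtain g where g: "bij_betw g {i..<CARD('n) - i} (unpaired i h j)"
    using finite_same_card_bij by (metis finite finite_atLeastLessThan)
  define T where "T x = (if fst x = Suc 0 then h (snd x) else if snd x < i then j (snd x) else g (snd x))"
    for x :: "nat \<times> nat"
  have bij: "bij_betw (f \<circ> snd) (Pair r ` X) Y" if "bij_betw f X Y"
    for f :: "nat \<Rightarrow> 'n" and r :: nat and X Y
    using that by (auto simp: bij_betw_def inj_on_def image_image)
  have cells: "cells ?\<mu> = Pair (Suc 0) ` {..<i} \<union> (Pair 0 ` {..<i} \<union> Pair 0 ` {i..<CARD('n) - i})"
    using i by (auto simp: cells_def less_Suc_eq numeral_2_eq_2 image_iff)
  have h: "bij_betw h {..<i} (h ` {..<i})" and j: "bij_betw j {..<i} (j ` {..<i})"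
    using pair by (simp_all add: pairing_def bij_betw_def)
  have "bij_betw T (Pair (Suc 0) ` {..<i}) (h ` {..<i})"
    using bij[OF h, of "Suc 0"] by (rule bij_betw_cong[THEN iffD1, rotated]) (auto simp: T_def)
  moreover have "bij_betw T (Pair 0 ` {..<i}) (j ` {..<i})"
    using bij[OF j, of 0] by (rule bij_betw_cong[THEN iffD1, rotated]) (auto simp: T_def)
  moreover have "bij_betw T (Pair 0 ` {i..<CARD('n) - i}) (unpaired i h j)"
    using bij[OF g, of 0] by (rule bij_betw_cong[THEN iffD1, rotated]) (auto simp: T_def)
  ultimately have "bij_betw T (cells ?\<mu>) (h ` {..<i} \<union> (j ` {..<i} \<union> unpaired i h j))"
    unfolding cells using pair
    by (intro bij_betw_combine) (auto simp: unpaired_def pairing_def)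
  moreover have "h ` {..<i} \<union> (j ` {..<i} \<union> unpaired i h j) = UNIV"
    by (auto simp: unpaired_def)
  ultimately have "tableau ?\<mu> T" by (simp add: tableau_def)
  then show thesis by (rule that) (simp_all add: T_def)
qed

lemma pair_coeff_cong:
  assumes "\<And>c. c < i \<Longrightarrow> h c = h' c" "\<And>c. c < i \<Longrightarrow> j c = j' c"
  shows "pair_coeff i p h j = pair_coeff i p h' j'"
  using assms by (simp add: pair_coeff_def pair_sign_def fun_eq_iff)

section \<open>The isomorphism with the Specht module\<close>

lemma subspace_specht: "tbl.subspace (specht \<mu>)"
  by (simp add: specht_def tbl.subspace_span)

text \<open>On a polytabloid the scalar comes from \<open>raise_pair_coeff\<close> followed by
  \<open>lower_pair_coeff\<close>, and it does not depend on the tableau, so linearity extends it to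
  the span. The second claim ensures that a Specht element is determined by its coefficients at the
  functions \<open>row_of D\<close>.\<close>

lemma lower_raise_specht:
  fixes v :: "'n::finite tabloids"
  assumes i: "2 * i + p \<le> CARD('n)" and v: "v \<in> specht [CARD('n) - i, i]"
  shows "lower i (raise i (i + p) (\<lambda>D. Poly_Mapping.lookup v (row_of D))) D =
      (-1) ^ i * of_nat ((CARD('n) - 2 * i) choose p) * Poly_Mapping.lookup v (row_of D)"
    (is "?l v D = ?c * _")
    and "t \<notin> range row_of \<Longrightarrow> Poly_Mapping.lookup v t = 0"
proof -
  have "?l v D = ?c * Poly_Mapping.lookup v (row_of D) \<and>
      (t \<notin> range row_of \<longrightarrow> Poly_Mapping.lookup v t = 0)"
    using v unfolding specht_def
  proof (induction v rule: tbl.span_induct_alt)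
    case base
    show ?case by (simp add: lower_def raise_def)
  next
    case (step a e w)
    then obtain T where e: "e = polytabloid [CARD('n) - i, i] T" and T: "tableau [CARD('n) - i, i] T"
      by blast
    interpret two_row_tableau i T by unfold_locales (use i T in simp_all)
    have "?l e D = ?c * Poly_Mapping.lookup e (row_of D)"
      using i by (simp add: e lookup_poly_tab_row_of raise_pair_coeff[OF pairing]
          card_unpaired[OF pairing] lower_pair_coeff[OF pairing])
    moreover have "?l (tbl_scale a e + w) D = a * ?l e D + ?l w D"
      by (simp add: lower_def raise_def lookup_add lookup_tbl_scale sum.distrib algebra_simps
          flip: sum_distrib_left)
    moreover have "t \<notin> range row_of \<Longrightarrow> Poly_Mapping.lookup e t = 0"
      unfolding e by (metis poly_tab_nonzero rangeI)
    ultimately show ?case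
      using step(2) by (auto simp: lookup_add lookup_tbl_scale algebra_simps)
  qed
  then show "?l v D = ?c * Poly_Mapping.lookup v (row_of D)"
    "t \<notin> range row_of \<Longrightarrow> Poly_Mapping.lookup v t = 0" by simp_all
qed

lemma inj_on_raise_tabloids:
  assumes "2 * i + p \<le> CARD('n::finite)"
  shows "inj_on (raise_tabloids i (i + p)) (specht [CARD('n) - i, i] :: 'n tabloids set)"
proof (rule inj_onI)
  fix v w :: "'n tabloids"
  assume v: "v \<in> specht [CARD('n) - i, i]" and w: "w \<in> specht [CARD('n) - i, i]"
    and eq: "raise_tabloids i (i + p) v = raise_tabloids i (i + p) w"
  have "raise i (i + p) (\<lambda>D. Poly_Mapping.lookup v (row_of D)) =
      raise i (i + p) (\<lambda>D. Poly_Mapping.lookup w (row_of D))"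
    using eq by (metis sf_coeff_raise_tabloids)
  then have "(-1) ^ i * of_nat ((CARD('n) - 2 * i) choose p) * Poly_Mapping.lookup v (row_of D) =
      (-1) ^ i * of_nat ((CARD('n) - 2 * i) choose p) * Poly_Mapping.lookup w (row_of D)" for D
    using lower_raise_specht(1)[OF assms v, of D] lower_raise_specht(1)[OF assms w, of D] by metis
  \<comment> \<open>The scalar can be cancelled because \<open>p\<close> is at most
    \<open>n - 2 * i\<close>.\<close>
  moreover have "(CARD('n) - 2 * i) choose p \<noteq> 0" using assms by simp
  ultimately have "Poly_Mapping.lookup v (row_of D) = Poly_Mapping.lookup w (row_of D)" for D
    by simp
  then show "v = w"
    using lower_raise_specht(2)[OF assms v] lower_raise_specht(2)[OF assms w]
    by (intro poly_mapping_eqI) (metis imageE)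
qed

text \<open>Each polytabloid goes to a multiple of a signed generator by
  \<open>hom_poly_tab\<close>. The lemma serves twice: for the inclusion map itself and for an
  arbitrary isomorphism onto a submodule.\<close>

lemma hom_image_specht:
  fixes \<phi> :: "'n::{finite, linorder} tabloids \<Rightarrow> 'n sf"
  assumes size: "2 * i + p \<le> CARD('n)"
    and add: "\<And>u v. u \<in> specht [CARD('n) - i, i] \<Longrightarrow> v \<in> specht [CARD('n) - i, i] \<Longrightarrow>
      \<phi> (u + v) = \<phi> u + \<phi> v"
    and scale: "\<And>c v. v \<in> specht [CARD('n) - i, i] \<Longrightarrow> \<phi> (tbl_scale c v) = sf_scale c (\<phi> v)"
    and act: "\<And>\<pi> v. \<pi> permutes UNIV \<Longrightarrow> v \<in> specht [CARD('n) - i, i] \<Longrightarrow>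
      \<phi> (tbl_act \<pi> v) = sf_act \<pi> (\<phi> v)"
    and deg: "\<phi> ` specht [CARD('n) - i, i] \<subseteq> sf_deg (i + p)"
  shows "\<phi> ` specht [CARD('n) - i, i] \<subseteq> sf.span (sf_generators i p)"
proof
  let ?S = "specht [CARD('n) - i, i] :: 'n tabloids set"
  fix u assume "u \<in> \<phi> ` ?S"
  then obtain v where u: "u = \<phi> v" and v: "v \<in> ?S" by blast
  \<comment> \<open>\<phi> is linear only on the Specht module, so membership in it is carried
    through the induction.\<close>
  from v have "v \<in> ?S \<and> \<phi> v \<in> sf.span (sf_generators i p)"
    unfolding specht_def
  proof (induction v rule: tbl.span_induct_alt)
    case base
    have "0 \<in> ?S" using subspace_specht by (rule tbl.subspace_0)
    then have "\<phi> 0 = 0" using scale[of 0 0] by simp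
    then show ?case using \<open>0 \<in> ?S\<close> by (simp add: sf.span_zero flip: specht_def)
  next
    case (step a e w)
    then obtain T where e: "e = polytabloid [CARD('n) - i, i] T" and T: "tableau [CARD('n) - i, i] T"
      by blast
    interpret two_row_tableau i T by unfold_locales (use size T in simp_all)
    have w: "w \<in> ?S" "\<phi> w \<in> sf.span (sf_generators i p)"
      using step(2) by (simp_all flip: specht_def)
    have e_mem: "e \<in> ?S" "tbl_scale a e \<in> ?S"
      using poly_tab_specht tbl.subspace_scale[OF subspace_specht] by (simp_all add: e)
    have "\<phi> poly_tab \<in> sf_deg (i + p)" using deg e_mem(1) by (auto simp: e)
    then obtain b where "\<phi> poly_tab = sf_scale b (sf_of (pair_coeff i p lo hi))"
      using hom_poly_tab[of \<phi> p] act scale size by blast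
    then have "\<phi> e \<in> sf.span (sf_generators i p)"
      by (simp add: e sf.span_scale sf_of_pair_coeff_in_span[OF pairing])
    moreover have "\<phi> (tbl_scale a e + w) = sf_scale a (\<phi> e) + \<phi> w"
      using add[OF e_mem(2) w(1)] scale[OF e_mem(1)] by simp
    moreover have "tbl_scale a e + w \<in> ?S"
      using e_mem(2) w(1) by (rule tbl.subspace_add[OF subspace_specht])
    ultimately show ?case
      using w(2) by (simp add: sf.span_add sf.span_scale flip: specht_def)
  qed
  then show "u \<in> sf.span (sf_generators i p)" by (simp add: u)
qed

text \<open>One inclusion is \<open>hom_image_specht\<close> for this map. For the other, the image
  is a subspace, and each generator is the image of the polytabloid of a tableau having its pairs as
  columns.\<close>

lemma raise_tabloids_image:
  assumes size: "2 * i + p \<le> CARD('n::{finite, linorder})"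
  shows "raise_tabloids i (i + p) ` (specht [CARD('n) - i, i] :: 'n tabloids set) =
    sf.span (sf_generators i p)"
proof
  let ?S = "specht [CARD('n) - i, i] :: 'n tabloids set"
  let ?\<phi> = "raise_tabloids i (i + p) :: 'n tabloids \<Rightarrow> 'n sf"
  show "?\<phi> ` ?S \<subseteq> sf.span (sf_generators i p)"
    by (rule hom_image_specht[OF size])
      (auto simp: raise_tabloids_add raise_tabloids_scale raise_tabloids_act sf_deg_iff
        sf_coeff_raise_tabloids raise_def)
  have "sf.subspace (?\<phi> ` ?S)"
  proof (rule sf.subspaceI)
    have "?\<phi> 0 = 0" using raise_tabloids_scale[of i "i + p" 0 "0 :: 'n tabloids"] by simp
    then show "0 \<in> ?\<phi> ` ?S" using tbl.subspace_0[OF subspace_specht] by (metis imageI)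
    fix x y and c assume "x \<in> ?\<phi> ` ?S"
    then obtain v where v: "x = ?\<phi> v" "v \<in> ?S" by blast
    show "sf_scale c x \<in> ?\<phi> ` ?S"
      using v tbl.subspace_scale[OF subspace_specht, of v] by (metis imageI raise_tabloids_scale)
    assume "y \<in> ?\<phi> ` ?S"
    then obtain w where "y = ?\<phi> w" "w \<in> ?S" by blast
    then show "x + y \<in> ?\<phi> ` ?S"
      using v tbl.subspace_add[OF subspace_specht, of v] by (metis imageI raise_tabloids_add)
  qed
  moreover have "sf_generators i p \<subseteq> ?\<phi> ` ?S"
  proof
    fix g :: "'n sf" assume "g \<in> sf_generators i p"
    then obtain h j where pair: "pairing i h j" and g: "g = sf_of (pair_coeff i p h j)"
      by (rule sf_generators_pairing)
    obtain T where T: "tableau [CARD('n) - i, i] T" "\<And>c. c < i \<Longrightarrow> T (Suc 0, c) = h c"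
      "\<And>c. c < i \<Longrightarrow> T (0, c) = j c"
      using pairing_tableau[OF pair] by blast
    interpret two_row_tableau i T by unfold_locales (use size T in simp_all)
    have "g = ?\<phi> poly_tab"
      using raise_tabloids_poly_tab[OF size] pair_coeff_cong[of i lo h hi j p] T(2,3) by (simp add: g)
    then show "g \<in> ?\<phi> ` ?S" using poly_tab_specht by blast
  qed
  ultimately show "sf.span (sf_generators i p) \<subseteq> ?\<phi> ` ?S"
    by (intro sf.span_minimal)
qed

lemma specht_iso_span_generators:
  assumes "2 * i + p \<le> CARD('n::{finite, linorder})"
  shows "specht_iso [CARD('n) - i, i] (sf.span (sf_generators i p) :: 'n sf set)"
  unfolding specht_iso_def
proof (intro exI[of _ "raise_tabloids i (i + p)"] conjI ballI allI impI)
  show "bij_betw (raise_tabloids i (i + p)) (specht [CARD('n) - i, i])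
      (sf.span (sf_generators i p) :: 'n sf set)"
    using inj_on_raise_tabloids[OF assms] raise_tabloids_image[OF assms] by (simp add: bij_betw_def)
qed (simp_all add: raise_tabloids_add raise_tabloids_scale raise_tabloids_act)

text \<open>Every submodule in the defining union lies in the span of the generators by
  \<open>hom_image_specht\<close>, and this span is itself one of those submodules.\<close>

lemma sf_component_eq_span:
  assumes size: "2 * i + p \<le> CARD('n::{finite, linorder})"
  shows "sf_component (i + p) [CARD('n) - i, i] = (sf.span (sf_generators i p) :: 'n sf set)"
proof
  let ?M = "sf.span (sf_generators i p) :: 'n sf set"
  have "U \<subseteq> ?M" if "U \<subseteq> sf_deg (i + p)" "specht_iso [CARD('n) - i, i] U" for U :: "'n sf set"
  proof -
    from that(2) obtain \<phi> where \<phi>: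
      "\<forall>u \<in> specht [CARD('n) - i, i]. \<forall>v \<in> specht [CARD('n) - i, i]. \<phi> (u + v) = \<phi> u + \<phi> v"
      "\<forall>c. \<forall>v \<in> specht [CARD('n) - i, i]. \<phi> (tbl_scale c v) = sf_scale c (\<phi> v)"
      "\<forall>\<pi>. \<pi> permutes UNIV \<longrightarrow>
        (\<forall>v \<in> specht [CARD('n) - i, i]. \<phi> (tbl_act \<pi> v) = sf_act \<pi> (\<phi> v))"
      and "bij_betw \<phi> (specht [CARD('n) - i, i]) U"
      unfolding specht_iso_def by blast
    then have U: "U = \<phi> ` specht [CARD('n) - i, i]" by (simp add: bij_betw_def)
    show ?thesis
      using that(1) \<phi> unfolding U by (intro hom_image_specht[OF size]) simp_all
  qed
  then show "sf_component (i + p) [CARD('n) - i, i] \<subseteq> ?M"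
    unfolding sf_component_def by (intro sf.span_minimal sf.subspace_span) blast
  have "?M \<subseteq> \<Union>{U. sf_submodule U \<and> U \<subseteq> sf_deg (i + p) \<and> specht_iso [CARD('n) - i, i] U}"
    using sf_submodule_span_generators span_generators_sf_deg specht_iso_span_generators[OF size]
    by blast
  then show "?M \<subseteq> sf_component (i + p) [CARD('n) - i, i]"
    unfolding sf_component_def using sf.span_superset by blast
qed

theorem proposition5p8:
  fixes i k :: nat
  assumes "i \<le> k" and "2 * k \<le> CARD('n)"
  shows "\<exists>B :: ('n :: {finite, linorder}) sf set.
    B \<subseteq> {sf_Delta hs js * sf_sigma (k - i) L |hs js L.
            length hs = i \<and> length js = i \<and> distinct (hs @ js) \<and>
            (\<forall>\<alpha> < i. hs ! \<alpha> < js ! \<alpha>) \<and>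
            set hs \<union> set js \<union> L = UNIV \<and> L \<inter> (set hs \<union> set js) = {}} \<and>
    sf.independent B \<and> sf.span B = sf_component k [CARD('n) - i, i]"
proof -
  obtain B :: "'n sf set" where B: "B \<subseteq> sf_generators i (k - i)" "sf.independent B"
    "sf_generators i (k - i) \<subseteq> sf.span B"
    by (rule sf.maximal_independent_subset)
  have "sf.span B = sf.span (sf_generators i (k - i))"
    using B by (meson sf.span_mono sf.span_minimal sf.subspace_span subset_antisym)
  \<comment> \<open>For \<open>p = k - i\<close> the condition \<open>2 * i + p <= n\<close> reads
    \<open>i + k <= n\<close>, which follows from \<open>i <= k\<close> and
    \<open>2 * k <= n\<close>.\<close>
  also have "\<dots> = sf_component k [CARD('n) - i, i]"
    using sf_component_eq_span[where i = i and p = "k - i" and 'n = 'n] assms by simp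
  finally show ?thesis
    using B unfolding sf_generators_def by blast
qed

end
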